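(* Let $K\subseteq\mathbb{R}^d$ be any compact set. Then the set $\{(\varphi|_K,d\varphi|_K):\varphi\in C_c^\infty(\mathbb{R}^d)\}$ is dense in $(\mathcal{J}^1(K),\|\cdot\|_{\mathcal{J}^1(K)})$. Consequently, $C^1(\mathbb{R}^d|K)=\{f|_K: f\in C^1(\mathbb{R}^d)\}$ is dense in $(C^1(K),\|\cdot\|_{C^1(K)})$.
   Context: A continuous $df:K\to\mathbb{R}^d$ is a continuous derivative of $f:K\to\mathbb{R}$ on $K$ if $\lim_{y\to x,\,y\in K\setminus\{x\}}\frac{f(y)-f(x)-\langle df(x),y-x\rangle}{|y-x|}=0$ for all $x\in K$. $\mathcal{J}^1(K)=\{(f,df): df \text{ is a continuous derivative of } f \text{ on } K\}$ with norm $\|f\|_K+\|df\|_K$ ($\|\cdot\|_K$ the sup norm). $C^1(K)$ is its projection onto the first coordinate with quotient norm $\|f\|_{C^1(K)}=\|f\|_K+\inf\{\|df\|_K: df \text{ a continuous derivative of } f\}$. *)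

theory Defs
  imports "HOL-Analysis.Analysis"
begin

definition supnorm :: "'a set \<Rightarrow> ('a \<Rightarrow> 'b::real_normed_vector) \<Rightarrow> real" where
  "supnorm K g = (if K = {} then 0 else (SUP x\<in>K. norm (g x)))"

definition is_cont_deriv :: "'a::euclidean_space set \<Rightarrow> ('a \<Rightarrow> real) \<Rightarrow> ('a \<Rightarrow> 'a) \<Rightarrow> bool" where
  "is_cont_deriv K f df \<longleftrightarrow> continuous_on K df \<and>
     (\<forall>x\<in>K. ((\<lambda>y. (f y - f x - df x \<bullet> (y - x)) / norm (y - x)) \<longlongrightarrow> 0) (at x within K))"

definition J1 :: "'a::euclidean_space set \<Rightarrow> (('a \<Rightarrow> real) \<times> ('a \<Rightarrow> 'a)) set" where
  "J1 K = {(f, df). is_cont_deriv K f df}"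

definition J1_norm :: "'a::euclidean_space set \<Rightarrow> ('a \<Rightarrow> real) \<times> ('a \<Rightarrow> 'a) \<Rightarrow> real" where
  "J1_norm K p = supnorm K (fst p) + supnorm K (snd p)"

definition C1K :: "'a::euclidean_space set \<Rightarrow> ('a \<Rightarrow> real) set" where
  "C1K K = {f. \<exists>df. is_cont_deriv K f df}"

definition C1K_norm :: "'a::euclidean_space set \<Rightarrow> ('a \<Rightarrow> real) \<Rightarrow> real" where
  "C1K_norm K f = supnorm K f + Inf {supnorm K df | df. is_cont_deriv K f df}"

coinductive smooth :: "('a::euclidean_space \<Rightarrow> real) \<Rightarrow> bool" where
  "(\<forall>x. f differentiable (at x)) \<Longrightarrow>
   (\<forall>b\<in>Basis. smooth (\<lambda>x. frechet_derivative f (at x) b)) \<Longrightarrow> smooth f"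

definition grad :: "('a::euclidean_space \<Rightarrow> real) \<Rightarrow> 'a \<Rightarrow> 'a" where
  "grad f x = (\<Sum>b\<in>Basis. frechet_derivative f (at x) b *\<^sub>R b)"

definition Cc_infty :: "('a::euclidean_space \<Rightarrow> real) set" where
  "Cc_infty = {\<phi>. smooth \<phi> \<and> compact (closure {x. \<phi> x \<noteq> 0})}"

definition C1_Rd :: "('a::euclidean_space \<Rightarrow> real) set" where
  "C1_Rd = {g. \<exists>dg. continuous_on UNIV dg \<and> (\<forall>x. (g has_derivative (\<lambda>h. dg x \<bullet> h)) (at x))}"

end

theory Submission
  imports Defs "HOL-Computational_Algebra.Polynomial"
begin

text \<open>Let \<open>df\<close> be a continuous derivative of \<open>f\<close> on \<open>K\<close>. Along a rectifiable curve in \<open>K\<close> the integral of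
  \<open>df\<close> is the increment of \<open>f\<close>; by compactness the Riemann sum of \<open>df\<close> along a chain of points of
  \<open>K\<close> with small steps and bounded length is therefore close to the increment of \<open>f\<close>. If moreover
  every chain pays \<open>\<epsilon>\<close> times its length, then the cheapest way to reach \<open>x\<close> by a \<open>\<delta>\<close>-chain,
  starting at \<open>a\<close> with initial cost \<open>f a\<close>, defines a function \<open>\<phi>\<close> which is uniformly close to \<open>f\<close>
  for small \<open>\<delta>\<close>. By construction \<open>\<phi>\<close> satisfies
  \<open>|\<phi> y - \<phi> x - df x \<bullet> (y - x)| \<le> 2 \<epsilon> |y - x|\<close> whenever \<open>|y - x| \<le> \<delta>\<close>: the pointwise
  differentiability has become uniform at scale \<open>\<delta>\<close>. Such a \<open>\<phi>\<close> is approximated, together with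
  \<open>df\<close>, by gluing its affine Taylor polynomials with a smooth partition of unity on a fine grid.\<close>

section \<open>Chains and uniform differentiability\<close>

text \<open>\<open>chain K G \<delta> a b s l\<close>: there is a finite sequence in \<open>K\<close> from \<open>a\<close> to \<open>b\<close> with steps of size at
  most \<open>\<delta>\<close>, of total length \<open>l\<close>, along which the left Riemann sum of \<open>G\<close> is \<open>s\<close>.\<close>

inductive chain ::
  "'a::euclidean_space set \<Rightarrow> ('a \<Rightarrow> 'a) \<Rightarrow> real \<Rightarrow> 'a \<Rightarrow> 'a \<Rightarrow> real \<Rightarrow> real \<Rightarrow> bool"
  for K :: "'a set" and G :: "'a \<Rightarrow> 'a" and \<delta> :: real where
  refl: "a \<in> K \<Longrightarrow> chain K G \<delta> a a 0 0"
| step: "chain K G \<delta> a b s l \<Longrightarrow> c \<in> K \<Longrightarrow> dist b c \<le> \<delta> \<Longrightarrow>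
    chain K G \<delta> a c (s + G b \<bullet> (c - b)) (l + dist b c)"

lemma chain_in: "chain K G \<delta> a b s l \<Longrightarrow> a \<in> K \<and> b \<in> K"
  by (induction rule: chain.induct) auto

lemma chain_length_nonneg: "chain K G \<delta> a b s l \<Longrightarrow> 0 \<le> l"
  by (induction rule: chain.induct) auto

lemma chain_dist_le: "chain K G \<delta> a b s l \<Longrightarrow> dist a b \<le> l"
proof (induction rule: chain.induct)
  case (step a b s l c)
  then show ?case using dist_triangle[of a c b] by linarith
qed auto

lemma chain_mono: "chain K G \<delta> a b s l \<Longrightarrow> \<delta> \<le> \<delta>' \<Longrightarrow> chain K G \<delta>' a b s l"
  by (induction rule: chain.induct) (auto intro: chain.intros)

text \<open>Cut at the vertex just before the length reaches \<open>t\<close>. A step is at most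
  \<open>\<delta>\<close> long, so the first part falls short of \<open>t\<close> by at most
  \<open>\<delta>\<close>.\<close>

lemma chain_split:
  assumes "chain K G \<delta> a b s l" "0 \<le> \<delta>" "0 \<le> t" "t \<le> l"
  shows "\<exists>c s1 l1. chain K G \<delta> a c s1 l1 \<and> chain K G \<delta> c b (s - s1) (l - l1) \<and>
    t - \<delta> \<le> l1 \<and> l1 \<le> t"
  using assms
proof (induction rule: chain.induct)
  case (refl a)
  then show ?case
    using chain.refl[of a K G \<delta>] by (intro exI[of _ a] exI[of _ 0]) auto
next
  case (step a b s l c)
  show ?case
  proof (cases "t \<le> l")
    case True
    then obtain d s1 l1 where d: "chain K G \<delta> a d s1 l1" "chain K G \<delta> d b (s - s1) (l - l1)"
      "t - \<delta> \<le> l1" "l1 \<le> t"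
      using step by blast
    from chain.step[OF d(2) \<open>c \<in> K\<close> \<open>dist b c \<le> \<delta>\<close>]
    have "chain K G \<delta> d c (s + G b \<bullet> (c - b) - s1) (l + dist b c - l1)"
      by (simp add: algebra_simps)
    with d show ?thesis by blast
  next
    case False
    have "b \<in> K" using chain_in step by blast
    from chain.step[OF chain.refl[OF this] \<open>c \<in> K\<close> \<open>dist b c \<le> \<delta>\<close>, of G]
    have "chain K G \<delta> b c (s + G b \<bullet> (c - b) - s) (l + dist b c - l)"
      by (simp add: algebra_simps)
    moreover have "t - \<delta> \<le> l" using step by linarith
    ultimately show ?thesis using step.hyps(1) False by (metis linear)
  qed
qed

text \<open>The difference splits into terms \<open>(G b - v) \<bullet> (c - b)\<close>, one per
  step, and every vertex stays within \<open>l < \<rho>\<close> of \<open>a\<close>, where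
  \<open>G\<close> is \<open>\<omega>\<close>-close to \<open>v\<close>.\<close>

lemma chain_sum_estimate:
  assumes "chain K G \<delta> a b s l" "l < \<rho>"
    and "\<And>x. x \<in> K \<Longrightarrow> dist a x < \<rho> \<Longrightarrow> norm (G x - v) \<le> \<omega>"
  shows "\<bar>s - v \<bullet> (b - a)\<bar> \<le> \<omega> * l"
  using assms
proof (induction rule: chain.induct)
  case (step a b s l c)
  have l: "l < \<rho>" using step.prems(1) zero_le_dist[of b c] by linarith
  then have "dist a b < \<rho>" using chain_dist_le[OF step.hyps(1)] by linarith
  then have w: "norm (G b - v) \<le> \<omega>" using chain_in[OF step.hyps(1)] step.prems by blast
  have "\<bar>(G b - v) \<bullet> (c - b)\<bar> \<le> norm (G b - v) * norm (c - b)"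
    by (rule Cauchy_Schwarz_ineq2)
  also have "\<dots> \<le> \<omega> * dist b c"
    using w by (simp add: dist_norm norm_minus_commute mult_right_mono)
  finally have "\<bar>(G b - v) \<bullet> (c - b)\<bar> \<le> \<omega> * dist b c" .
  moreover have "\<bar>s - v \<bullet> (b - a)\<bar> \<le> \<omega> * l" using step.IH[OF l] step.prems by blast
  moreover have "s + G b \<bullet> (c - b) - v \<bullet> (c - a) = (s - v \<bullet> (b - a)) + (G b - v) \<bullet> (c - b)"
    by (simp add: algebra_simps)
  ultimately show ?case by (simp add: algebra_simps)
qed auto

lemma chain_sum_bound:
  assumes "chain K G \<delta> a b s l" "\<And>x. x \<in> K \<Longrightarrow> norm (G x) \<le> B"
  shows "\<bar>s\<bar> \<le> B * l"
  using chain_sum_estimate[OF assms(1), of "l + 1" 0 B] assms(2) by simp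

section \<open>Limits of chains with vanishing steps\<close>

text \<open>A stand-in for a curve in \<open>K\<close> from \<open>a\<close> to \<open>b\<close>
  along which \<open>G\<close> has integral \<open>s\<close>. Only points and numbers are recorded,
  so compactness applies to them directly and no parametrised curve has to be constructed.\<close>

definition limit_chain ::
  "'a::euclidean_space set \<Rightarrow> ('a \<Rightarrow> 'a) \<Rightarrow> 'a \<Rightarrow> 'a \<Rightarrow> real \<Rightarrow> real \<Rightarrow> bool" where
  "limit_chain K G a b s l \<longleftrightarrow> (\<exists>\<delta> A B S L. \<delta> \<longlonglongrightarrow> 0 \<and> A \<longlonglongrightarrow> a \<and> B \<longlonglongrightarrow> b \<and> S \<longlonglongrightarrow> s \<and> L \<longlonglongrightarrow> l \<and>
    (\<forall>n. 0 \<le> \<delta> n \<and> chain K G (\<delta> n) (A n) (B n) (S n) (L n)))"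

lemma limit_chain_in:
  assumes "limit_chain K G a b s l" "closed K"
  shows "a \<in> K" "b \<in> K"
proof -
  obtain A B where "A \<longlonglongrightarrow> a" "B \<longlonglongrightarrow> b" "\<And>n. A n \<in> K" "\<And>n. B n \<in> K"
    using assms(1) unfolding limit_chain_def by (meson chain_in)
  then show "a \<in> K" "b \<in> K" using assms(2) closed_sequentially by blast+
qed

lemma limit_chain_dist_le:
  assumes "limit_chain K G a b s l"
  shows "dist a b \<le> l"
proof -
  obtain A B L where "A \<longlonglongrightarrow> a" "B \<longlonglongrightarrow> b" "L \<longlonglongrightarrow> l" and le: "\<And>n. dist (A n) (B n) \<le> L n"
    using assms unfolding limit_chain_def by (meson chain_dist_le)
  then show ?thesis
    by (intro LIMSEQ_le[OF tendsto_dist \<open>L \<longlonglongrightarrow> l\<close>]) auto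
qed

lemma limit_chain_sum_estimate:
  assumes "limit_chain K G a b s l" "l < \<rho>"
    and w: "\<And>x. x \<in> K \<Longrightarrow> dist a x < \<rho> \<Longrightarrow> norm (G x - v) \<le> \<omega>"
  shows "\<bar>s - v \<bullet> (b - a)\<bar> \<le> \<omega> * l"
proof -
  obtain \<delta> A B S L where lims: "A \<longlonglongrightarrow> a" "B \<longlonglongrightarrow> b" "S \<longlonglongrightarrow> s" "L \<longlonglongrightarrow> l"
    and ch: "\<And>n. chain K G (\<delta> n) (A n) (B n) (S n) (L n)"
    using assms(1) unfolding limit_chain_def by blast
  \<comment> \<open>The midpoint shares the room between \<open>l\<close> and \<open>\<rho>\<close>:
    eventually \<open>L n < \<sigma>\<close>, and the \<open>\<sigma>\<close>-ball around
    \<open>A n\<close> lies in the \<open>\<rho>\<close>-ball around \<open>a\<close>.\<close>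
  define \<sigma> where "\<sigma> = (l + \<rho>) / 2"
  have \<sigma>: "l < \<sigma>" "\<sigma> < \<rho>" using assms(2) by (auto simp: \<sigma>_def)
  have "\<forall>\<^sub>F n in sequentially. L n < \<sigma>" by (rule order_tendstoD(2)[OF lims(4) \<sigma>(1)])
  moreover have "\<forall>\<^sub>F n in sequentially. dist (A n) a < \<rho> - \<sigma>" by (rule tendstoD[OF lims(1)]) (use \<sigma> in simp)
  ultimately have "\<forall>\<^sub>F n in sequentially. \<bar>S n - v \<bullet> (B n - A n)\<bar> \<le> \<omega> * L n"
  proof eventually_elim
    case (elim n)
    show ?case
    proof (rule chain_sum_estimate[OF ch elim(1)])
      fix x assume "x \<in> K" "dist (A n) x < \<sigma>"
      then show "norm (G x - v) \<le> \<omega>"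
        using w elim(2) dist_triangle[of a x "A n"] by (simp add: dist_commute)
    qed
  qed
  then show ?thesis
    by (intro tendsto_le[OF _ _ _ , of sequentially "\<lambda>n. \<omega> * L n" "\<omega> * l"
          "\<lambda>n. \<bar>S n - v \<bullet> (B n - A n)\<bar>"]) (auto intro!: tendsto_intros lims)
qed

text \<open>Each approximating chain is split near half its length. The error
  \<open>\<delta> n\<close> vanishes in the limit, and by compactness a subsequence of the cut
  points and partial sums converges.\<close>

lemma limit_chain_bisect:
  assumes lc: "limit_chain K G a b s l" and K: "compact K" and G: "continuous_on K G"
  obtains c s1 where "limit_chain K G a c s1 (l/2)" "limit_chain K G c b (s - s1) (l/2)"
proof -
  obtain \<delta> A B S L where lims: "\<delta> \<longlonglongrightarrow> 0" "A \<longlonglongrightarrow> a" "B \<longlonglongrightarrow> b" "S \<longlonglongrightarrow> s" "L \<longlonglongrightarrow> l"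
    and ch: "\<And>n. chain K G (\<delta> n) (A n) (B n) (S n) (L n)" and \<delta>: "\<And>n. 0 \<le> \<delta> n"
    using lc unfolding limit_chain_def by blast
  have "\<exists>c s1 l1. chain K G (\<delta> n) (A n) c s1 l1 \<and> chain K G (\<delta> n) c (B n) (S n - s1) (L n - l1) \<and>
    L n / 2 - \<delta> n \<le> l1 \<and> l1 \<le> L n / 2" for n
    using chain_split[OF ch[of n] \<delta>[of n], of "L n / 2"] chain_length_nonneg[OF ch[of n]] by auto
  then obtain C S1 L1 where
    C1: "\<And>n. chain K G (\<delta> n) (A n) (C n) (S1 n) (L1 n)" and
    C2: "\<And>n. chain K G (\<delta> n) (C n) (B n) (S n - S1 n) (L n - L1 n)" and
    L1: "\<And>n. L n / 2 - \<delta> n \<le> L1 n" "\<And>n. L1 n \<le> L n / 2"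
    by metis
  have "L1 \<longlonglongrightarrow> l / 2"
    by (rule tendsto_sandwich[of "\<lambda>n. L n / 2 - \<delta> n" _ _ "\<lambda>n. L n / 2"])
       (use L1 lims in \<open>auto intro!: tendsto_eq_intros\<close>)
  \<comment> \<open>The bound on \<open>G\<close> and the bounded lengths confine the partial sums
    to a compact interval.\<close>
  obtain g where g: "\<And>x. x \<in> K \<Longrightarrow> norm (G x) \<le> g" "0 < g"
    using compact_imp_bounded[OF compact_continuous_image[OF G K]]
    unfolding bounded_pos by auto
  obtain m where m: "\<And>n. \<bar>L1 n\<bar> \<le> m"
    using convergent_imp_Bseq[OF convergentI[OF \<open>L1 \<longlonglongrightarrow> l / 2\<close>]] unfolding Bseq_def by auto
  have "\<bar>S1 n\<bar> \<le> g * m" for n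
    using chain_sum_bound[OF C1 g(1), of n] m[of n] g(2)
    by (smt (verit) mult_left_mono)
  then have S1: "S1 n \<in> {-(g*m)..g*m}" for n by (simp add: abs_le_iff) (smt (verit))
  define Z where "Z n = (C n, S1 n)" for n
  have "seq_compact (K \<times> {-(g*m)..g*m})"
    by (intro compact_imp_seq_compact compact_Times K compact_Icc)
  moreover have "\<forall>n. Z n \<in> K \<times> {-(g*m)..g*m}"
    unfolding Z_def using chain_in[OF C1] S1 by blast
  ultimately obtain p r where r: "strict_mono r" "(Z \<circ> r) \<longlonglongrightarrow> p"
    unfolding seq_compact_def by meson
  obtain c s1 where p: "p = (c, s1)" by fastforce
  have c: "(C \<circ> r) \<longlonglongrightarrow> c" using tendsto_fst[OF r(2)] by (simp add: p o_def Z_def)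
  have s1: "(S1 \<circ> r) \<longlonglongrightarrow> s1" using tendsto_snd[OF r(2)] by (simp add: p o_def Z_def)
  note sub = LIMSEQ_subseq_LIMSEQ[OF _ r(1)]
  show ?thesis
  proof
    show "limit_chain K G a c s1 (l/2)"
      unfolding limit_chain_def
      by (rule exI[of _ "\<delta> \<circ> r"], rule exI[of _ "A \<circ> r"], rule exI[of _ "C \<circ> r"],
          rule exI[of _ "S1 \<circ> r"], rule exI[of _ "L1 \<circ> r"])
         (use lims c s1 \<open>L1 \<longlonglongrightarrow> l / 2\<close> C1 \<delta> in \<open>auto intro: sub\<close>)
    have "(\<lambda>n. (S \<circ> r) n - (S1 \<circ> r) n) \<longlonglongrightarrow> s - s1"
      by (intro tendsto_diff sub lims s1)
    moreover have "(\<lambda>n. (L \<circ> r) n - (L1 \<circ> r) n) \<longlonglongrightarrow> l / 2"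
      using tendsto_diff[OF sub[OF lims(5)] sub[OF \<open>L1 \<longlonglongrightarrow> l / 2\<close>]] by simp
    ultimately show "limit_chain K G c b (s - s1) (l/2)"
      unfolding limit_chain_def
      by (intro exI[of _ "\<delta> \<circ> r"] exI[of _ "C \<circ> r"] exI[of _ "B \<circ> r"]
            exI[of _ "\<lambda>n. (S \<circ> r) n - (S1 \<circ> r) n"] exI[of _ "\<lambda>n. (L \<circ> r) n - (L1 \<circ> r) n"])
         (use lims c C2 \<delta> in \<open>auto intro: sub\<close>)
  qed
qed

section \<open>Exactness of Riemann sums in the limit\<close>

text \<open>Multiplying out the difference quotient admits \<open>y = x\<close>, and a single radius
  serves both \<open>f\<close> and \<open>df\<close>.\<close>

lemma is_cont_deriv_eps:
  assumes "is_cont_deriv K f df" "x \<in> K" "0 < \<kappa>"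
  obtains d where "0 < d"
    "\<And>y. y \<in> K \<Longrightarrow> dist y x < d \<Longrightarrow> \<bar>f y - f x - df x \<bullet> (y - x)\<bar> \<le> \<kappa> * dist y x"
    "\<And>y. y \<in> K \<Longrightarrow> dist y x < d \<Longrightarrow> norm (df y - df x) \<le> \<kappa>"
proof -
  have "((\<lambda>y. (f y - f x - df x \<bullet> (y - x)) / norm (y - x)) \<longlongrightarrow> 0) (at x within K)"
    using assms unfolding is_cont_deriv_def by blast
  then have "\<forall>\<^sub>F y in at x within K. dist ((f y - f x - df x \<bullet> (y - x)) / norm (y - x)) 0 < \<kappa>"
    by (rule tendstoD[OF _ assms(3)])
  then obtain d1 where d1: "0 < d1"
    "\<And>y. y \<in> K \<Longrightarrow> y \<noteq> x \<Longrightarrow> dist y x < d1 \<Longrightarrow>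
      \<bar>(f y - f x - df x \<bullet> (y - x)) / norm (y - x)\<bar> < \<kappa>"
    unfolding eventually_at dist_real_def diff_zero by blast
  have 1: "\<bar>f y - f x - df x \<bullet> (y - x)\<bar> \<le> \<kappa> * dist y x" if "y \<in> K" "dist y x < d1" for y
  proof (cases "y = x")
    case False
    then show ?thesis using d1(2)[OF that(1) False that(2)]
      by (simp add: dist_norm abs_divide divide_less_eq)
  qed auto
  have "continuous_on K df" using assms unfolding is_cont_deriv_def by blast
  then obtain d2 where d2: "0 < d2" "\<And>y. y \<in> K \<Longrightarrow> dist y x < d2 \<Longrightarrow> dist (df y) (df x) < \<kappa>"
    using assms(2,3) unfolding continuous_on_iff by metis
  show ?thesis
    by (rule that[of "min d1 d2"]) (use d1(1) d2 1 in \<open>auto simp: dist_norm less_imp_le\<close>)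
qed

lemma is_cont_deriv_imp_continuous_on:
  assumes "is_cont_deriv K f df"
  shows "continuous_on K f"
  unfolding continuous_on_def
proof
  fix x assume x: "x \<in> K"
  obtain d where d: "0 < d"
    "\<And>y. y \<in> K \<Longrightarrow> dist y x < d \<Longrightarrow> \<bar>f y - f x - df x \<bullet> (y - x)\<bar> \<le> 1 * dist y x"
    using is_cont_deriv_eps[OF assms x zero_less_one] by metis
  have "norm (f y - f x) \<le> dist y x + \<bar>df x \<bullet> (y - x)\<bar>" if "y \<in> K" "dist y x < d" for y
    using d(2)[OF that] by simp
  then have "\<forall>\<^sub>F y in at x within K. norm (f y - f x) \<le> dist y x + \<bar>df x \<bullet> (y - x)\<bar>"
    using d(1) unfolding eventually_at by blast
  moreover have "((\<lambda>y. dist y x + \<bar>df x \<bullet> (y - x)\<bar>) \<longlongrightarrow> 0) (at x within K)"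
    by (auto intro!: tendsto_eq_intros)
  ultimately have "((\<lambda>y. f y - f x) \<longlongrightarrow> 0) (at x within K)"
    by (rule Lim_null_comparison)
  then show "(f \<longlongrightarrow> f x) (at x within K)" using LIM_zero_cancel by blast
qed

text \<open>Halving repeatedly, the defect of one half is at least half of the defect. The halves shrink
  to a point of \<open>K\<close>, where differentiability makes the defect negligible against the length.\<close>

lemma limit_chain_exact:
  assumes lc: "limit_chain K df a b s l" and K: "compact K" and f: "is_cont_deriv K f df"
  shows "s = f b - f a"
proof (rule ccontr)
  assume ne: "s \<noteq> f b - f a"
  define \<eta> where "\<eta> = \<bar>f b - f a - s\<bar>"
  have \<eta>: "0 < \<eta>" using ne by (auto simp: \<eta>_def)
  have l: "0 \<le> l" using limit_chain_dist_le[OF lc] zero_le_dist[of a b] by linarith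
  have G: "continuous_on K df" using f by (simp add: is_cont_deriv_def)
  \<comment> \<open>The defect is additive under bisection, so one half inherits at least half of
    it.\<close>
  have abs_half: "e/2 \<le> \<bar>u\<bar> \<or> e/2 \<le> \<bar>v\<bar>" if "e \<le> \<bar>u + v\<bar>" for e u v :: real
    using that by linarith
  \<comment> \<open>\<open>P\<close> says that length and defect are both halved at each stage, the
    latter at worst; \<open>Q\<close> makes the starting points a Cauchy sequence.\<close>
  define P where "P n = (\<lambda>(a, b, s). limit_chain K df a b s (l/2^n) \<and> \<eta>/2^n \<le> \<bar>f b - f a - s\<bar>)" for n
  define Q where "Q n = (\<lambda>(a, b :: 'a, s :: real) (a' :: 'a, b' :: 'a, s' :: real). dist a a' \<le> l/2^Suc n)" for n
  have "\<exists>X. \<forall>n. P n (X n) \<and> Q n (X n) (X (Suc n))"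
  proof (rule dependent_nat_choice)
    show "\<exists>x. P 0 x" by (rule exI[of _ "(a, b, s)"]) (simp add: P_def lc \<eta>_def)
  next
    fix x n assume "P n x"
    then obtain a b s where x: "x = (a, b, s)" and lcn: "limit_chain K df a b s (l/2^n)"
      and de: "\<eta>/2^n \<le> \<bar>f b - f a - s\<bar>"
      unfolding P_def by (cases x) auto
    obtain c s1 where c: "limit_chain K df a c s1 (l/2^n/2)" "limit_chain K df c b (s - s1) (l/2^n/2)"
      using limit_chain_bisect[OF lcn K G] .
    have "\<eta>/2^n/2 \<le> \<bar>f c - f a - s1\<bar> \<or> \<eta>/2^n/2 \<le> \<bar>f b - f c - (s - s1)\<bar>"
      using abs_half[of "\<eta>/2^n" "f c - f a - s1" "f b - f c - (s - s1)"] de by simp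
    then show "\<exists>y. P (Suc n) y \<and> Q n x y"
    proof
      assume "\<eta>/2^n/2 \<le> \<bar>f c - f a - s1\<bar>"
      then show ?thesis using c l
        by (intro exI[of _ "(a, c, s1)"]) (simp add: P_def Q_def x mult.commute)
    next
      assume "\<eta>/2^n/2 \<le> \<bar>f b - f c - (s - s1)\<bar>"
      then show ?thesis using c limit_chain_dist_le[OF c(1)]
        by (intro exI[of _ "(c, b, s - s1)"]) (simp add: P_def Q_def x mult.commute)
    qed
  qed
  then obtain X where X: "\<And>n. P n (X n)" "\<And>n. Q n (X n) (X (Suc n))" by blast
  define A where "A n = fst (X n)" for n
  define B where "B n = fst (snd (X n))" for n
  define S where "S n = snd (snd (X n))" for n
  have lcn: "limit_chain K df (A n) (B n) (S n) (l/2^n)"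
    and de: "\<eta>/2^n \<le> \<bar>f (B n) - f (A n) - S n\<bar>" for n
    using X(1)[of n] by (auto simp: P_def A_def B_def S_def split_beta)
  have st: "dist (A n) (A (Suc n)) \<le> l/2^Suc n" for n
    using X(2)[of n] by (auto simp: Q_def A_def split_beta)
  have AB: "A n \<in> K" "B n \<in> K" for n
    using limit_chain_in[OF lcn compact_imp_closed[OF K]] by blast+
  \<comment> \<open>The geometric series of the displacements, in telescoped form.\<close>
  have d1: "dist (A n) (A (n + j)) \<le> l/2^n - l/2^(n+j)" for n j
  proof (induction j)
    case (Suc j)
    have "dist (A n) (A (n + Suc j)) \<le> dist (A n) (A (n + j)) + dist (A (n+j)) (A (Suc (n + j)))"
      by (simp add: dist_triangle)
    also have "\<dots> \<le> (l/2^n - l/2^(n+j)) + l/2^Suc(n+j)" by (intro add_mono Suc st)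
    also have "\<dots> = l/2^n - l/2^(n+Suc j)" by (simp add: field_simps)
    finally show ?case .
  qed auto
  obtain x r where x: "x \<in> K" and r: "strict_mono r" "(A \<circ> r) \<longlonglongrightarrow> x"
    using compact_imp_seq_compact[OF K] AB(1) unfolding seq_compact_def by metis
  have dx: "dist (A n) x \<le> l/2^n" for n
  proof (rule LIMSEQ_le_const2)
    show "(\<lambda>m. dist (A n) ((A \<circ> r) m)) \<longlonglongrightarrow> dist (A n) x"
      by (intro tendsto_intros r)
    have "dist (A n) (A (r m)) \<le> l/2^n" if "n \<le> m" for m
    proof -
      have "n \<le> r m" using that strict_mono_imp_increasing[OF r(1), of m] by linarith
      then have "dist (A n) (A (r m)) \<le> l/2^n - l/2^(r m)" using d1[of n "r m - n"] by simp
      then show ?thesis using l by (smt (verit) divide_nonneg_nonneg zero_le_power)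
    qed
    then show "\<exists>N. \<forall>m\<ge>N. dist (A n) ((A \<circ> r) m) \<le> l/2^n" by auto
  qed
  \<comment> \<open>The errors below add up to \<open>(1 + 1 + 2) * \<kappa>\<close> times
    \<open>l/2^n\<close>. The summand 1 in \<open>l + 1\<close> covers \<open>l = 0\<close> and
    makes the final inequality strict.\<close>
  define \<kappa> where "\<kappa> = \<eta> / (4 * (l + 1))"
  have \<kappa>: "0 < \<kappa>" using \<eta> l by (simp add: \<kappa>_def)
  obtain d where d: "0 < d"
    "\<And>y. y \<in> K \<Longrightarrow> dist y x < d \<Longrightarrow> \<bar>f y - f x - df x \<bullet> (y - x)\<bar> \<le> \<kappa> * dist y x"
    "\<And>y. y \<in> K \<Longrightarrow> dist y x < d \<Longrightarrow> norm (df y - df x) \<le> \<kappa>"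
    using is_cont_deriv_eps[OF f x \<kappa>] by metis
  obtain n where n: "(1/2)^n < d / (3 * (l + 1))"
    using real_arch_pow_inv[of "d / (3 * (l + 1))" "1/2"] d(1) l by auto
  \<comment> \<open>A radius strictly above \<open>l/2^n\<close>, as the sum estimate requires, and
    so small that the \<open>q\<close>-ball around \<open>A n\<close> and the point
    \<open>B n\<close> lie in the \<open>d\<close>-ball around \<open>x\<close>.\<close>
  define q where "q = (l + 1) / 2^n"
  have q: "3 * q < d" using n l by (simp add: q_def power_divide field_simps)
  have lq: "l/2^n < q" by (simp add: q_def divide_strict_right_mono)
  have q0: "0 < q" using l by (simp add: q_def)
  have Ax: "dist (A n) x < q" using dx[of n] lq by linarith
  have AnBn: "dist (A n) (B n) \<le> l/2^n" by (rule limit_chain_dist_le[OF lcn])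
  have Bx: "dist (B n) x \<le> 2 * (l/2^n)"
    using AnBn dx[of n] dist_triangle[of "B n" x "A n"] by (simp add: dist_commute)
  have "\<bar>S n - df x \<bullet> (B n - A n)\<bar> \<le> \<kappa> * (l/2^n)"
  proof (rule limit_chain_sum_estimate[OF lcn lq])
    fix y assume "y \<in> K" "dist (A n) y < q"
    then show "norm (df y - df x) \<le> \<kappa>"
      using d(3)[of y] Ax q q0 dist_triangle[of y x "A n"] by (simp add: dist_commute)
  qed
  moreover have "\<bar>f (A n) - f x - df x \<bullet> (A n - x)\<bar> \<le> \<kappa> * (l/2^n)"
  proof -
    have "dist (A n) x < d" using Ax q q0 by linarith
    then have "\<bar>f (A n) - f x - df x \<bullet> (A n - x)\<bar> \<le> \<kappa> * dist (A n) x"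
      by (rule d(2)[OF AB(1)])
    also have "\<dots> \<le> \<kappa> * (l/2^n)" using dx \<kappa> by (intro mult_left_mono) auto
    finally show ?thesis .
  qed
  moreover have "\<bar>f (B n) - f x - df x \<bullet> (B n - x)\<bar> \<le> \<kappa> * (2 * (l/2^n))"
  proof -
    have "dist (B n) x < d" using Bx q lq q0 by linarith
    then have "\<bar>f (B n) - f x - df x \<bullet> (B n - x)\<bar> \<le> \<kappa> * dist (B n) x"
      by (rule d(2)[OF AB(2)])
    also have "\<dots> \<le> \<kappa> * (2 * (l/2^n))" using Bx \<kappa> by (intro mult_left_mono) auto
    finally show ?thesis .
  qed
  \<comment> \<open>The linear terms at \<open>x\<close> cancel, so the defect is a combination of
    the three errors just bounded.\<close>
  moreover have "f (B n) - f (A n) - S n = (f (B n) - f x - df x \<bullet> (B n - x))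
      - (f (A n) - f x - df x \<bullet> (A n - x)) - (S n - df x \<bullet> (B n - A n))"
    by (simp add: inner_diff_right)
  ultimately have "\<bar>f (B n) - f (A n) - S n\<bar> \<le> 4 * \<kappa> * (l/2^n)" by linarith
  also have "\<dots> < \<eta>/2^n"
  proof -
    have "4 * \<kappa> * l < \<eta>" using \<eta> l by (simp add: \<kappa>_def field_simps)
    then show ?thesis by (simp add: divide_strict_right_mono)
  qed
  finally show False using de[of n] by linarith
qed

section \<open>Uniform bounds for chains with small steps\<close>

text \<open>Otherwise there are chains with steps at most \<open>1/(n+1)\<close>, length at most
  \<open>M\<close> and defect above \<open>\<eta>\<close>. Their endpoints, sums and lengths lie in
  a compact set, and a subsequence yields a limit chain with defect at least \<open>\<eta>\<close>,
  contrary to \<open>limit_chain_exact\<close>.\<close>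

lemma short_chain_defect:
  assumes K: "compact K" and f: "is_cont_deriv K f df" and \<eta>: "0 < \<eta>"
  obtains \<delta> where "0 < \<delta>"
    "\<And>a b s l. chain K df \<delta> a b s l \<Longrightarrow> l \<le> M \<Longrightarrow> \<bar>f b - f a - s\<bar> \<le> \<eta>"
proof -
  have "\<exists>\<delta>>0. \<forall>a b s l. chain K df \<delta> a b s l \<longrightarrow> l \<le> M \<longrightarrow> \<bar>f b - f a - s\<bar> \<le> \<eta>"
  proof (rule ccontr)
    assume neg: "\<not> ?thesis"
    define \<delta> where "\<delta> n = inverse (real (Suc n))" for n
    have \<delta>: "0 < \<delta> n" for n by (simp add: \<delta>_def)
    from neg \<delta> have "\<exists>a b s l. chain K df (\<delta> n) a b s l \<and> l \<le> M \<and> \<eta> < \<bar>f b - f a - s\<bar>" for n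
      by (meson not_le)
    then obtain A B S L where ch: "\<And>n. chain K df (\<delta> n) (A n) (B n) (S n) (L n)"
      and LM: "\<And>n. L n \<le> M" and de: "\<And>n. \<eta> < \<bar>f (B n) - f (A n) - S n\<bar>"
      by metis
    have G: "continuous_on K df" using f by (simp add: is_cont_deriv_def)
    obtain g where g: "\<And>x. x \<in> K \<Longrightarrow> norm (df x) \<le> g" "0 < g"
      using compact_imp_bounded[OF compact_continuous_image[OF G K]]
      unfolding bounded_pos by auto
    have L: "L n \<in> {0..M}" for n using chain_length_nonneg[OF ch] LM by auto
    have "\<bar>S n\<bar> \<le> g * M" for n
      using chain_sum_bound[OF ch g(1), of n] LM[of n] g(2)
      by (smt (verit) mult_left_mono)
    then have S: "S n \<in> {-(g*M)..g*M}" for n by (simp add: abs_le_iff) (smt (verit))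
    define T where "T = (K \<times> K) \<times> ({-(g*M)..g*M} \<times> {0..M})"
    define Z where "Z n = ((A n, B n), (S n, L n))" for n
    have "seq_compact T" unfolding T_def
      by (intro compact_imp_seq_compact compact_Times K compact_Icc)
    moreover have "\<forall>n. Z n \<in> T"
      unfolding T_def Z_def using chain_in[OF ch] L S by auto
    ultimately obtain p r where p: "p \<in> T" and r: "strict_mono r" "(Z \<circ> r) \<longlonglongrightarrow> p"
      unfolding seq_compact_def by meson
    obtain a b s l where p': "p = ((a, b), (s, l))" by (metis surj_pair)
    have lims: "(A \<circ> r) \<longlonglongrightarrow> a" "(B \<circ> r) \<longlonglongrightarrow> b" "(S \<circ> r) \<longlonglongrightarrow> s" "(L \<circ> r) \<longlonglongrightarrow> l"
      using tendsto_fst[OF tendsto_fst[OF r(2)]] tendsto_snd[OF tendsto_fst[OF r(2)]]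
        tendsto_fst[OF tendsto_snd[OF r(2)]] tendsto_snd[OF tendsto_snd[OF r(2)]]
      by (simp_all add: p' o_def Z_def)
    have ab: "a \<in> K" "b \<in> K" using p p' by (auto simp: T_def)
    have "\<delta> \<longlonglongrightarrow> 0" unfolding \<delta>_def by (rule LIMSEQ_inverse_real_of_nat)
    then have "(\<delta> \<circ> r) \<longlonglongrightarrow> 0" using LIMSEQ_subseq_LIMSEQ r(1) by blast
    then have "limit_chain K df a b s l"
      unfolding limit_chain_def
      by (intro exI[of _ "\<delta> \<circ> r"] exI[of _ "A \<circ> r"] exI[of _ "B \<circ> r"]
            exI[of _ "S \<circ> r"] exI[of _ "L \<circ> r"])
         (use lims ch \<delta> in \<open>auto intro: less_imp_le\<close>)
    then have s: "s = f b - f a" by (rule limit_chain_exact[OF _ K f])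
    have "continuous_on K f" by (rule is_cont_deriv_imp_continuous_on[OF f])
    then have fl: "(\<lambda>n. f ((A \<circ> r) n)) \<longlonglongrightarrow> f a" "(\<lambda>n. f ((B \<circ> r) n)) \<longlonglongrightarrow> f b"
      by (intro continuous_on_tendsto_compose[of K f] lims ab; use chain_in[OF ch] in simp)+
    have "(\<lambda>n. \<bar>f ((B \<circ> r) n) - f ((A \<circ> r) n) - (S \<circ> r) n\<bar>) \<longlonglongrightarrow> \<bar>f b - f a - s\<bar>"
      by (intro tendsto_intros fl lims)
    then have "\<eta> \<le> \<bar>f b - f a - s\<bar>"
      by (rule LIMSEQ_le_const) (use de in \<open>auto intro: less_imp_le\<close>)
    then show False using s \<eta> by simp
  qed
  then show ?thesis using that by blast
qed

text \<open>The length penalty pays for the defects of the pieces of length about 1 into which a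
  long chain is cut.\<close>

lemma chain_cost_lower_bound:
  assumes K: "compact K" and f: "is_cont_deriv K f df" and "0 < \<epsilon>" "0 < \<eta>"
  obtains \<delta> where "0 < \<delta>"
    "\<And>a b s l. chain K df \<delta> a b s l \<Longrightarrow> f b - f a - \<eta> \<le> s + \<epsilon> * l"
proof -
  \<comment> \<open>The defect of a completed piece must be covered by \<open>\<epsilon>\<close>
    times a length above 1, that of the last piece by \<open>\<eta>\<close>.\<close>
  define \<eta>' where "\<eta>' = min \<eta> \<epsilon>"
  have \<eta>': "0 < \<eta>'" "\<eta>' \<le> \<eta>" "\<eta>' \<le> \<epsilon>" using assms by (auto simp: \<eta>'_def)
  obtain \<delta>0 where \<delta>0: "0 < \<delta>0"
    "\<And>a b s l. chain K df \<delta>0 a b s l \<Longrightarrow> l \<le> 2 \<Longrightarrow> \<bar>f b - f a - s\<bar> \<le> \<eta>'"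
    using short_chain_defect[OF K f \<eta>'(1), of 2] by metis
  \<comment> \<open>Steps of size at most 1 keep a tail of length at most 1, extended by one step,
    within the length 2 for which the defect is controlled.\<close>
  define \<delta> where "\<delta> = min \<delta>0 1"
  have \<delta>: "0 < \<delta>" "\<delta> \<le> 1" using \<delta>0 by (auto simp: \<delta>_def)
  have short: "\<bar>f b - f a - s\<bar> \<le> \<eta>'" if "chain K df \<delta> a b s l" "l \<le> 2" for a b s l
    using \<delta>0(2) chain_mono[OF that(1), of \<delta>0] that(2) by (simp add: \<delta>_def)
  \<comment> \<open>The invariant: up to the cut point \<open>c\<close> the cost dominates the
    increment of \<open>f\<close> without any error, and the tail after \<open>c\<close> has length
    at most 1.\<close>
  have cut: "\<exists>c s2 l2. chain K df \<delta> c b s2 l2 \<and> l2 \<le> 1 \<and> f c - f a \<le> (s - s2) + \<epsilon> * (l - l2)"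
    if "chain K df \<delta> a b s l" for a b s l
    using that
  proof (induction rule: chain.induct)
    case (refl a)
    then show ?case
      by (intro exI[of _ a] exI[of _ 0]) (auto intro: chain.refl)
  next
    case (step a b s l d)
    then obtain c s2 l2 where c: "chain K df \<delta> c b s2 l2" "l2 \<le> 1"
      "f c - f a \<le> (s - s2) + \<epsilon> * (l - l2)" by blast
    let ?s = "s2 + df b \<bullet> (d - b)" and ?l = "l2 + dist b d"
    have ch: "chain K df \<delta> c d ?s ?l"
      using chain.step[OF c(1) step.hyps(2,3)] .
    show ?case
    proof (cases "?l \<le> 1")
      case True
      then show ?thesis using ch c(3) by (intro exI[of _ c] exI[of _ ?s] exI[of _ ?l]) simp
    next
      case False
      have "?l \<le> 2" using c(2) step.hyps(3) \<delta>(2) by linarith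
      then have "f d - f c \<le> ?s + \<eta>'" using short[OF ch] by linarith
      \<comment> \<open>A tail longer than 1 pays for its own defect, so the cut moves to
        \<open>d\<close> and the new tail is empty.\<close>
      also have "\<eta>' \<le> \<epsilon> * ?l" using False \<eta>'(3) \<open>0 < \<epsilon>\<close>
        by (smt (verit) mult_le_cancel_left1)
      finally have "f d - f a \<le> (s + df b \<bullet> (d - b)) + \<epsilon> * (l + dist b d)"
        using c(3) by (simp add: algebra_simps)
      then show ?thesis using chain.refl[OF step.hyps(2), of df \<delta>]
        by (intro exI[of _ d] exI[of _ 0]) simp
    qed
  qed
  show ?thesis
  proof (rule that[OF \<delta>(1)])
    fix a b s l assume "chain K df \<delta> a b s l"
    then obtain c s2 l2 where c: "chain K df \<delta> c b s2 l2" "l2 \<le> 1"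
      "f c - f a \<le> (s - s2) + \<epsilon> * (l - l2)" using cut by blast
    have "f b - f c \<le> s2 + \<eta>" using short[OF c(1)] c(2) \<eta>'(2) by linarith
    moreover have "0 \<le> \<epsilon> * l2" using chain_length_nonneg[OF c(1)] \<open>0 < \<epsilon>\<close> by simp
    ultimately show "f b - f a - \<eta> \<le> s + \<epsilon> * l" using c(3) by (simp add: algebra_simps)
  qed
qed

text \<open>The trivial chain gives \<open>\<phi> \<le> f\<close>, the cost bound gives
  \<open>f - \<eta> \<le> \<phi>\<close>. Appending the step to \<open>y\<close> to chains reaching
  \<open>x\<close> bounds \<open>\<phi> y\<close> from above. Exchanging \<open>x\<close> and
  \<open>y\<close> gives the other side, where replacing \<open>df y\<close> by \<open>df x\<close>
  costs the second \<open>\<epsilon>\<close>.\<close>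

lemma uniform_derivative_approximation:
  assumes K: "compact K" and f: "is_cont_deriv K f df" and \<epsilon>: "0 < \<epsilon>" and \<eta>: "0 < \<eta>"
  obtains \<phi> \<delta> where "0 < \<delta>" "\<And>x. x \<in> K \<Longrightarrow> \<bar>f x - \<phi> x\<bar> \<le> \<eta>"
    "\<And>x y. x \<in> K \<Longrightarrow> y \<in> K \<Longrightarrow> dist x y \<le> \<delta> \<Longrightarrow> norm (df y - df x) \<le> \<epsilon>"
    "\<And>x y. x \<in> K \<Longrightarrow> y \<in> K \<Longrightarrow> dist x y \<le> \<delta> \<Longrightarrow>
      \<bar>\<phi> y - \<phi> x - df x \<bullet> (y - x)\<bar> \<le> 2 * \<epsilon> * dist x y"
proof -
  obtain \<delta>0 where \<delta>0: "0 < \<delta>0"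
    "\<And>a b s l. chain K df \<delta>0 a b s l \<Longrightarrow> f b - f a - \<eta> \<le> s + \<epsilon> * l"
    using chain_cost_lower_bound[OF K f \<epsilon> \<eta>] by metis
  have "uniformly_continuous_on K df"
    using f K compact_uniformly_continuous unfolding is_cont_deriv_def by blast
  then obtain \<delta>1 where \<delta>1: "0 < \<delta>1"
    "\<And>x y. x \<in> K \<Longrightarrow> y \<in> K \<Longrightarrow> dist y x < \<delta>1 \<Longrightarrow> dist (df y) (df x) < \<epsilon>"
    using \<epsilon> unfolding uniformly_continuous_on_def by metis
  \<comment> \<open>Halving \<open>\<delta>1\<close> turns its strict bound into one valid for
    \<open>dist x y \<le> \<delta>\<close>.\<close>
  define \<delta> where "\<delta> = min \<delta>0 (\<delta>1 / 2)"
  have \<delta>: "0 < \<delta>" using \<delta>0 \<delta>1 by (simp add: \<delta>_def)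
  have low: "f b - f a - \<eta> \<le> s + \<epsilon> * l" if "chain K df \<delta> a b s l" for a b s l
    using \<delta>0(2) chain_mono[OF that, of \<delta>0] by (simp add: \<delta>_def)
  have uc: "norm (df y - df x) \<le> \<epsilon>" if "x \<in> K" "y \<in> K" "dist x y \<le> \<delta>" for x y
  proof -
    have "dist y x < \<delta>1" using that(3) \<delta>1(1) by (simp add: \<delta>_def dist_commute)
    from \<delta>1(2)[OF that(1,2) this] show ?thesis by (simp add: dist_norm)
  qed
  define C where "C x = {f a + s + \<epsilon> * l | a s l. chain K df \<delta> a x s l}" for x
  define \<phi> where "\<phi> x = Inf (C x)" for x
  have bdd: "bdd_below (C x)" for x
    by (rule bdd_belowI[of _ "f x - \<eta>"]) (use low in \<open>force simp: C_def\<close>)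
  have in_C: "f x \<in> C x" if "x \<in> K" for x
    unfolding C_def
    by (rule CollectI, rule exI[of _ x], rule exI[of _ 0], rule exI[of _ 0]) (simp add: chain.refl that)
  have up: "\<phi> x \<le> f x" if "x \<in> K" for x
    unfolding \<phi>_def by (rule cInf_lower[OF in_C[OF that] bdd])
  have lo: "f x - \<eta> \<le> \<phi> x" if "x \<in> K" for x
    unfolding \<phi>_def by (rule cInf_greatest) (use in_C[OF that] low in \<open>force simp: C_def\<close>)+
  have inc: "\<phi> y \<le> \<phi> x + df x \<bullet> (y - x) + \<epsilon> * dist x y"
    if "x \<in> K" "y \<in> K" "dist x y \<le> \<delta>" for x y
  proof -
    have "\<phi> y - df x \<bullet> (y - x) - \<epsilon> * dist x y \<le> Inf (C x)"
    proof (rule cInf_greatest)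
      show "C x \<noteq> {}" using in_C[OF that(1)] by blast
      fix z assume "z \<in> C x"
      then obtain a s l where z: "z = f a + s + \<epsilon> * l" "chain K df \<delta> a x s l" by (auto simp: C_def)
      from chain.step[OF z(2) that(2,3)]
      have "f a + (s + df x \<bullet> (y - x)) + \<epsilon> * (l + dist x y) \<in> C y" unfolding C_def by blast
      then have "\<phi> y \<le> f a + (s + df x \<bullet> (y - x)) + \<epsilon> * (l + dist x y)"
        unfolding \<phi>_def by (rule cInf_lower[OF _ bdd])
      then show "\<phi> y - df x \<bullet> (y - x) - \<epsilon> * dist x y \<le> z" by (simp add: z algebra_simps)
    qed
    then show ?thesis by (simp add: \<phi>_def)
  qed
  show ?thesis
  proof (rule that[OF \<delta>, of \<phi>])
    fix x assume "x \<in> K"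
    then show "\<bar>f x - \<phi> x\<bar> \<le> \<eta>" using up lo by (smt (verit) \<eta>)
  next
    fix x y assume xy: "x \<in> K" "y \<in> K" "dist x y \<le> \<delta>"
    show "norm (df y - df x) \<le> \<epsilon>" by (rule uc[OF xy])
    have "\<bar>(df y - df x) \<bullet> (y - x)\<bar> \<le> norm (df y - df x) * norm (y - x)"
      by (rule Cauchy_Schwarz_ineq2)
    also have "\<dots> \<le> \<epsilon> * dist x y"
      using uc[OF xy] by (simp add: dist_norm norm_minus_commute mult_right_mono)
    finally have "\<bar>df y \<bullet> (y - x) - df x \<bullet> (y - x)\<bar> \<le> \<epsilon> * dist x y" by (simp add: inner_diff_left)
    moreover have "\<phi> x \<le> \<phi> y - df y \<bullet> (y - x) + \<epsilon> * dist x y"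
      using inc[of y x] xy by (simp add: dist_commute inner_diff_right)
    ultimately show "\<bar>\<phi> y - \<phi> x - df x \<bullet> (y - x)\<bar> \<le> 2 * \<epsilon> * dist x y"
      using inc[OF xy] by (simp add: abs_le_iff)
  qed
qed

section \<open>Smooth functions\<close>

text \<open>Finite levels of the coinductive \<open>smooth\<close>, so that closure properties can
  be proved by induction on \<open>n\<close>. Level 0 demands nothing, not even continuity; the
  conjunction of all levels is smoothness all the same.\<close>

primrec Ck :: "nat \<Rightarrow> ('a::euclidean_space \<Rightarrow> real) \<Rightarrow> bool" where
  "Ck 0 f \<longleftrightarrow> True"
| "Ck (Suc n) f \<longleftrightarrow> (\<forall>x. f differentiable (at x)) \<and>
    (\<forall>b\<in>Basis. Ck n (\<lambda>x. frechet_derivative f (at x) b))"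

lemma smooth_iff_Ck: "smooth f \<longleftrightarrow> (\<forall>n. Ck n f)"
proof
  assume "smooth f"
  have "smooth f \<Longrightarrow> Ck n f" for n
    by (induction n arbitrary: f) (auto elim: smooth.cases)
  then show "\<forall>n. Ck n f" using \<open>smooth f\<close> by blast
next
  assume "\<forall>n. Ck n f"
  then show "smooth f"
  proof (coinduction arbitrary: f)
    case smooth
    then show ?case by (metis Ck.simps(2))
  qed
qed

text \<open>The product rule contains undifferentiated factors; they are given at level
  \<open>Suc n\<close> and have to be used at level \<open>n\<close>.\<close>

lemma Ck_Suc_imp_Ck: "Ck (Suc n) f \<Longrightarrow> Ck n f"
proof (induction n arbitrary: f)
  case (Suc n)
  then have "\<forall>b\<in>Basis. Ck (Suc n) (\<lambda>x. frechet_derivative f (at x) b)"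
    by (metis Ck.simps(2))
  then show ?case using Suc by (metis Ck.simps(2))
qed auto

lemma Ck_SucI:
  assumes "\<And>x. (f has_derivative f' x) (at x)" "\<And>b. b \<in> Basis \<Longrightarrow> Ck n (\<lambda>x. f' x b)"
  shows "Ck (Suc n) f"
proof -
  have "frechet_derivative f (at x) = f' x" for x
    using frechet_derivative_at[OF assms(1)] by simp
  then show ?thesis using assms by (auto simp: differentiable_def)
qed

lemma Ck_SucD:
  assumes "Ck (Suc n) f"
  shows "(f has_derivative frechet_derivative f (at x)) (at x)"
    "b \<in> Basis \<Longrightarrow> Ck n (\<lambda>x. frechet_derivative f (at x) b)"
  using assms by (auto simp: frechet_derivative_works)

lemma Ck_const: "Ck n (\<lambda>x. c)"
  by (induction n arbitrary: c) (auto intro!: Ck_SucI)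

lemma Ck_add: "Ck n f \<Longrightarrow> Ck n g \<Longrightarrow> Ck n (\<lambda>x. f x + g x)"
proof (induction n arbitrary: f g)
  case (Suc n)
  show ?case
    by (rule Ck_SucI[OF has_derivative_add[OF Ck_SucD(1)[OF Suc.prems(1)] Ck_SucD(1)[OF Suc.prems(2)]]])
       (intro Suc.IH Ck_SucD(2) Suc.prems)
qed auto

lemma Ck_mult: "Ck n f \<Longrightarrow> Ck n g \<Longrightarrow> Ck n (\<lambda>x. f x * g x)"
proof (induction n arbitrary: f g)
  case (Suc n)
  show ?case
    by (rule Ck_SucI[OF has_derivative_mult[OF Ck_SucD(1)[OF Suc.prems(1)] Ck_SucD(1)[OF Suc.prems(2)]]])
       (intro Ck_add Suc.IH Ck_SucD(2) Suc.prems Ck_Suc_imp_Ck)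
qed auto

lemma Ck_sum: "(\<And>i. i \<in> I \<Longrightarrow> Ck n (f i)) \<Longrightarrow> Ck n (\<lambda>x. \<Sum>i\<in>I. f i x)"
  by (induction I rule: infinite_finite_induct) (auto intro: Ck_const Ck_add)

lemma Ck_prod: "(\<And>i. i \<in> I \<Longrightarrow> Ck n (f i)) \<Longrightarrow> Ck n (\<lambda>x. \<Prod>i\<in>I. f i x)"
  by (induction I rule: infinite_finite_induct) (auto intro: Ck_const Ck_mult)

lemma Ck_inner: "Ck n (\<lambda>x. v \<bullet> x)"
proof (cases n)
  case (Suc m)
  show ?thesis unfolding Suc
    by (rule Ck_SucI[of _ "\<lambda>_ x. v \<bullet> x"]) (auto intro!: derivative_eq_intros Ck_const)
qed auto

text \<open>The partial derivatives are constants times \<open>g'\<close> composed with the same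
  affine map, so the induction closes when \<open>g\<close> is arbitrary.\<close>

lemma Ck_compose_affine:
  fixes g :: "real \<Rightarrow> real" and v :: "'a::euclidean_space"
  shows "Ck n g \<Longrightarrow> Ck n (\<lambda>x. g (v \<bullet> x + c))"
proof (induction n arbitrary: g)
  case (Suc n)
  have 1: "((\<lambda>x. g (v \<bullet> x + c)) has_derivative
      (\<lambda>h. (v \<bullet> h) * frechet_derivative g (at (v \<bullet> x + c)) 1)) (at x)" for x
  proof -
    have g: "(g has_derivative frechet_derivative g (at (v \<bullet> x + c))) (at (v \<bullet> x + c))"
      by (rule Ck_SucD(1)[OF Suc.prems])
    have D: "frechet_derivative g (at (v \<bullet> x + c)) t = t * frechet_derivative g (at (v \<bullet> x + c)) 1" for t
      using linear_cmul[OF has_derivative_linear[OF g], of t 1] by simp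
    have "((\<lambda>x. v \<bullet> x + c) has_derivative (\<lambda>h. v \<bullet> h)) (at x)"
      by (auto intro!: derivative_eq_intros)
    from has_derivative_compose[OF this g]
    have "((\<lambda>x. g (v \<bullet> x + c)) has_derivative
      (\<lambda>h. frechet_derivative g (at (v \<bullet> x + c)) (v \<bullet> h))) (at x)" .
    moreover have "(\<lambda>h. frechet_derivative g (at (v \<bullet> x + c)) (v \<bullet> h)) =
      (\<lambda>h. (v \<bullet> h) * frechet_derivative g (at (v \<bullet> x + c)) 1)"
      by (rule ext) (rule D)
    ultimately show ?thesis by simp
  qed
  have "Ck n (\<lambda>x. frechet_derivative g (at x) 1)" using Suc.prems by simp
  from Suc.IH[OF this] show ?case
    by (intro Ck_SucI[OF 1] Ck_mult Ck_const) auto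
qed auto

lemma smooth_const: "smooth (\<lambda>x. c)"
  and smooth_inner: "smooth (\<lambda>x. v \<bullet> x)"
  by (auto simp: smooth_iff_Ck intro: Ck_const Ck_inner)

lemma smooth_add: "smooth f \<Longrightarrow> smooth g \<Longrightarrow> smooth (\<lambda>x. f x + g x)"
  and smooth_mult: "smooth f \<Longrightarrow> smooth g \<Longrightarrow> smooth (\<lambda>x. f x * g x)"
  by (auto simp: smooth_iff_Ck intro: Ck_add Ck_mult)

lemma smooth_sum: "(\<And>i. i \<in> I \<Longrightarrow> smooth (f i)) \<Longrightarrow> smooth (\<lambda>x. \<Sum>i\<in>I. f i x)"
  and smooth_prod: "(\<And>i. i \<in> I \<Longrightarrow> smooth (f i)) \<Longrightarrow> smooth (\<lambda>x. \<Prod>i\<in>I. f i x)"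
  by (auto simp: smooth_iff_Ck intro: Ck_sum Ck_prod)

lemma smooth_compose_affine: "smooth g \<Longrightarrow> smooth (\<lambda>x. g (v \<bullet> x + c))"
  by (auto simp: smooth_iff_Ck intro: Ck_compose_affine)

lemma smooth_has_derivative: "smooth f \<Longrightarrow> (f has_derivative frechet_derivative f (at x)) (at x)"
  by (auto simp: frechet_derivative_works elim: smooth.cases)

lemma smooth_partial: "smooth f \<Longrightarrow> b \<in> Basis \<Longrightarrow> smooth (\<lambda>x. frechet_derivative f (at x) b)"
  by (auto elim: smooth.cases)

lemma smooth_continuous_on: "smooth f \<Longrightarrow> continuous_on A f"
  using smooth_has_derivative has_derivative_continuous continuous_at_imp_continuous_on by metis

lemma has_real_derivative_frechet_derivative:
  assumes "(f has_real_derivative D) (at x)"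
  shows "frechet_derivative f (at x) b = D * b"
  using fun_cong[OF frechet_derivative_at[OF assms[unfolded has_field_derivative_def]], of b] by simp

lemma smooth_real_antiderivative:
  assumes "\<And>x. (F has_real_derivative f x) (at x)" "smooth f"
  shows "smooth F"
proof (rule smooth.intros)
  show "\<forall>x. F differentiable at x" using assms(1) real_differentiable_def by blast
  show "\<forall>b\<in>Basis. smooth (\<lambda>x. frechet_derivative F (at x) b)"
    using assms(2) has_real_derivative_frechet_derivative[OF assms(1)] by simp
qed

section \<open>A smooth step from the exponential\<close>

text \<open>The polynomial factor makes the family of all \<open>flat p\<close> closed under differentiation.\<close>

definition flat :: "real poly \<Rightarrow> real \<Rightarrow> real" where
  "flat p t = (if 0 < t then poly p (inverse t) * exp (- inverse t) else 0)"

lemma poly_mult_exp_neg_tendsto_0: "((\<lambda>u. poly p u * exp (- u)) \<longlongrightarrow> 0) at_top" for p :: "real poly"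
proof -
  have "((\<lambda>u. \<Sum>i\<le>degree p. coeff p i * (u ^ i / exp u)) \<longlongrightarrow> (\<Sum>i\<le>degree p. coeff p i * 0)) at_top"
    by (intro tendsto_intros tendsto_power_div_exp_0)
  moreover have "(\<Sum>i\<le>degree p. coeff p i * (u ^ i / exp u)) = poly p u * exp (- u)" for u
    by (simp add: poly_altdef exp_minus sum_distrib_right divide_inverse mult.assoc)
  ultimately show ?thesis by simp
qed

text \<open>With \<open>u = inverse t\<close>, the derivative of \<open>poly p u * exp (- u)\<close>
  in \<open>t\<close> is \<open>u^2 * poly (p - pderiv p) u * exp (- u)\<close>, and
  \<open>[:0, 0, 1:]\<close> is the polynomial \<open>u^2\<close>. At 0 the exponential beats every
  polynomial in \<open>u\<close>.\<close>

lemma flat_has_derivative: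
  "(flat p has_real_derivative flat ([:0, 0, 1:] * (p - pderiv p)) t) (at t)"
proof -
  consider "0 < t" | "t < 0" | "t = 0" by linarith
  then show ?thesis
  proof cases
    case 1
    have "((\<lambda>t. poly p (inverse t) * exp (- inverse t)) has_real_derivative
        flat ([:0, 0, 1:] * (p - pderiv p)) t) (at t)"
      using 1 by (auto intro!: derivative_eq_intros
          simp: flat_def power2_eq_square field_simps)
    then show ?thesis
      by (rule has_field_derivative_transform_within_open[of _ _ _ "{0<..}"])
         (use 1 in \<open>auto simp: flat_def\<close>)
  next
    case 2
    have "((\<lambda>t. 0) has_real_derivative 0) (at t)" by simp
    then have "(flat p has_real_derivative 0) (at t)"
      by (rule has_field_derivative_transform_within_open[of _ _ _ "{..<0}"])
         (use 2 in \<open>auto simp: flat_def\<close>)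
    then show ?thesis using 2 by (simp add: flat_def)
  next
    case 3
    \<comment> \<open>Dividing by \<open>t\<close> multiplies by \<open>u = inverse t\<close>, so
      the right difference quotient at 0 is again a polynomial in \<open>u\<close> times
      \<open>exp (- u)\<close>.\<close>
    have "((\<lambda>t. poly ([:0, 1:] * p) (inverse t) * exp (- inverse t)) \<longlongrightarrow> 0) (at_right 0)"
      using filterlim_compose[OF poly_mult_exp_neg_tendsto_0 filterlim_inverse_at_top_right] .
    then have "((\<lambda>t. flat p t / t) \<longlongrightarrow> 0) (at_right 0)"
      by (rule Lim_transform_eventually)
         (auto simp: eventually_at_right_field flat_def divide_inverse intro!: exI[of _ 1])
    moreover have "((\<lambda>t. flat p t / t) \<longlongrightarrow> 0) (at_left 0)"
      by (rule Lim_transform_eventually[OF tendsto_const])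
         (auto simp: eventually_at_left_field flat_def intro!: exI[of _ "-1"])
    ultimately have "((\<lambda>t. flat p t / t) \<longlongrightarrow> 0) (at 0)"
      by (simp add: filterlim_split_at)
    then show ?thesis using 3 by (simp add: has_field_derivative_iff flat_def)
  qed
qed

lemma smooth_flat: "smooth (flat p)"
proof -
  have "Ck n (flat p)" for n
  proof (induction n arbitrary: p)
    case (Suc n)
    have "flat p differentiable at x" for x
      using flat_has_derivative real_differentiable_def by blast
    then show ?case
      using Suc has_real_derivative_frechet_derivative[OF flat_has_derivative] by simp
  qed auto
  then show ?thesis by (simp add: smooth_iff_Ck)
qed


text \<open>The step is a normalised primitive of a bump \<open>g\<close> that is positive exactly
  on the open unit interval.\<close>

lemma smooth_step_exists:
  obtains H :: "real \<Rightarrow> real" where "smooth H" "mono H"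
    "\<And>t. t \<le> 0 \<Longrightarrow> H t = 0" "\<And>t. 1 \<le> t \<Longrightarrow> H t = 1"
proof -
  define g where "g t = flat 1 t * flat 1 (1 - t)" for t
  have "smooth (\<lambda>t. flat 1 ((-1) \<bullet> (t::real) + 1))" by (rule smooth_compose_affine[OF smooth_flat])
  then have "smooth (\<lambda>t. flat 1 (1 - t))" by (simp add: inner_real_def)
  then have g: "smooth g" unfolding g_def by (rule smooth_mult[OF smooth_flat])
  have g0: "0 \<le> g t" for t by (simp add: g_def flat_def)
  have gpos: "0 < g t" if "0 < t" "t < 1" for t using that by (simp add: g_def flat_def)
  have gz: "g t = 0" if "t \<le> 0 \<or> 1 \<le> t" for t using that by (auto simp: g_def flat_def)
  have "isCont g x" for x
    using smooth_continuous_on[OF g, of UNIV] by (simp add: continuous_on_eq_continuous_at)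
  then obtain F where "\<And>x. (F has_vector_derivative g x) (at x)"
    using einterval_antiderivative[of "-\<infinity>" "\<infinity>" g] by auto
  then have F: "(F has_real_derivative g x) (at x)" for x
    by (simp add: has_real_derivative_iff_has_vector_derivative)
  have cF: "continuous_on A F" for A
    using F DERIV_isCont continuous_at_imp_continuous_on by blast
  have mono: "F x \<le> F y" if "x \<le> y" for x y
    by (rule DERIV_nonneg_imp_nondecreasing[OF that]) (use F g0 in blast)
  have F0: "F t = F 0" if "t \<le> 0" for t
  proof (cases "t < 0")
    case True
    have "F 0 = F t"
    proof (rule DERIV_isconst_end[OF True cF])
      fix x :: real assume "x < 0"
      then show "(F has_real_derivative 0) (at x)" using F[of x] gz[of x] by simp
    qed
    then show ?thesis by simp
  qed (use that in simp)
  have F1: "F t = F 1" if "1 \<le> t" for t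
  proof (cases "1 < t")
    case True
    show ?thesis
    proof (rule DERIV_isconst_end[OF True cF])
      fix x :: real assume "1 < x"
      then show "(F has_real_derivative 0) (at x)" using F[of x] gz[of x] by simp
    qed
  qed (use that in simp)
  have "F 0 < F 1"
    by (rule DERIV_pos_imp_increasing_open[OF zero_less_one _ cF]) (use F gpos in blast)
  define c where "c = inverse (F 1 - F 0)"
  have c: "0 < c" using \<open>F 0 < F 1\<close> by (simp add: c_def)
  define H where "H t = c * (F t + (- F 0))" for t
  show ?thesis
  proof (rule that)
    show "smooth H" unfolding H_def
      by (intro smooth_mult smooth_add smooth_const smooth_real_antiderivative[OF F g])
    show "mono H" unfolding H_def mono_def using mono c by (auto intro: mult_left_mono)
    show "H t = 0" if "t \<le> 0" for t using F0[OF that] by (simp add: H_def)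
    show "H t = 1" if "1 \<le> t" for t using F1[OF that] \<open>F 0 < F 1\<close> by (simp add: H_def c_def)
  qed
qed

section \<open>Patching on a grid\<close>

text \<open>As \<open>h\<close> is the difference of two unit translates of a step \<open>H\<close>,
  its integer translates telescope to \<open>H (t + N + 1) - H (t - N)\<close>, which is
  \<open>1 - 0\<close> when \<open>\<bar>t\<bar> \<le> N\<close>.\<close>

lemma smooth_unit_translates_exist:
  obtains h :: "real \<Rightarrow> real" where "smooth h" "\<And>t. 0 \<le> h t" "\<And>t. 1 \<le> \<bar>t\<bar> \<Longrightarrow> h t = 0"
    "\<And>N t. \<bar>t\<bar> \<le> real N \<Longrightarrow> (\<Sum>j\<in>{-int N..int N}. h (t - of_int j)) = 1"
proof -
  obtain H :: "real \<Rightarrow> real" where H: "smooth H" "mono H"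
    "\<And>t. t \<le> 0 \<Longrightarrow> H t = 0" "\<And>t. 1 \<le> t \<Longrightarrow> H t = 1"
    using smooth_step_exists by metis
  define h where "h t = H (t + 1) + (-1) * H t" for t
  have tele: "(\<Sum>j\<in>{-int N..int N}. h (t - of_int j)) = H (t + real N + 1) - H (t - real N)" for N t
  proof (induction N)
    case (Suc N)
    have "{-int (Suc N)..int (Suc N)} = insert (-int (Suc N)) (insert (int (Suc N)) {-int N..int N})"
      by auto
    then have "(\<Sum>j\<in>{-int (Suc N)..int (Suc N)}. h (t - of_int j)) =
        h (t - of_int (-int (Suc N))) + (h (t - of_int (int (Suc N))) + (\<Sum>j\<in>{-int N..int N}. h (t - of_int j)))"
      by (simp only:) (subst sum.insert; simp)+
    also have "\<dots> = H (t + real (Suc N) + 1) - H (t - real (Suc N))"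
      unfolding Suc by (simp add: h_def algebra_simps)
    finally show ?case .
  qed (simp add: h_def)
  have "smooth (\<lambda>t. H (1 \<bullet> (t::real) + 1))" by (rule smooth_compose_affine[OF H(1)])
  then have "smooth (\<lambda>t. H (t + 1))" by (simp add: inner_real_def)
  show ?thesis
  proof (rule that)
    show "smooth h" unfolding h_def
      by (intro smooth_add smooth_mult smooth_const H(1) \<open>smooth (\<lambda>t. H (t + 1))\<close>)
    show "0 \<le> h t" for t using monoD[OF H(2), of t "t + 1"] by (simp add: h_def)
    show "h t = 0" if "1 \<le> \<bar>t\<bar>" for t
      using that H(3)[of t] H(3)[of "t + 1"] H(4)[of t] H(4)[of "t + 1"] by (auto simp: h_def abs_if split: if_splits)
    show "(\<Sum>j\<in>{-int N..int N}. h (t - of_int j)) = 1" if "\<bar>t\<bar> \<le> real N" for N t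
      using that H(3)[of "t - real N"] H(4)[of "t + real N + 1"] by (simp add: tele abs_le_iff)
  qed
qed

definition grid_point :: "('a::euclidean_space \<Rightarrow> int) \<Rightarrow> 'a" where
  "grid_point k = (\<Sum>b\<in>Basis. of_int (k b) *\<^sub>R b)"

lemma grid_point_inner: "b \<in> Basis \<Longrightarrow> b \<bullet> grid_point k = of_int (k b)"
  by (simp add: grid_point_def inner_sum_right inner_Basis if_distrib cong: if_cong)

text \<open>Take the product of \<open>h\<close> over the coordinates: distributivity turns the
  product of the one-dimensional sums into the sum over the lattice. The derivative is bounded
  because it is continuous and vanishes outside a compact cube.\<close>

lemma smooth_grid_bump_exists:
  obtains \<beta> :: "'a::euclidean_space \<Rightarrow> real" and C :: real where
    "0 \<le> C" "\<And>c w. smooth (\<lambda>x. \<beta> (c *\<^sub>R x - w))" "\<And>y. 0 \<le> \<beta> y"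
    "\<And>y b. b \<in> Basis \<Longrightarrow> 1 < \<bar>b \<bullet> y\<bar> \<Longrightarrow> \<beta> y = 0"
    "\<And>y. (\<beta> has_derivative frechet_derivative \<beta> (at y)) (at y)"
    "\<And>y v. \<bar>frechet_derivative \<beta> (at y) v\<bar> \<le> C * norm v"
    "\<And>y b v. b \<in> Basis \<Longrightarrow> 1 < \<bar>b \<bullet> y\<bar> \<Longrightarrow> frechet_derivative \<beta> (at y) v = 0"
    "\<And>N y. (\<And>b. b \<in> Basis \<Longrightarrow> \<bar>b \<bullet> y\<bar> \<le> real N) \<Longrightarrow>
      (\<Sum>k\<in>PiE Basis (\<lambda>_. {-int N..int N}). \<beta> (y - grid_point k)) = 1"
proof -
  obtain h :: "real \<Rightarrow> real" where h: "smooth h" "\<And>t. 0 \<le> h t" "\<And>t. 1 \<le> \<bar>t\<bar> \<Longrightarrow> h t = 0"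
    "\<And>N t. \<bar>t\<bar> \<le> real N \<Longrightarrow> (\<Sum>j\<in>{-int N..int N}. h (t - of_int j)) = 1"
    using smooth_unit_translates_exist by metis
  define \<beta> :: "'a \<Rightarrow> real" where "\<beta> y = (\<Prod>b\<in>Basis. h (b \<bullet> y))" for y
  have sm: "smooth (\<lambda>x. \<beta> (c *\<^sub>R x - w))" for c w
  proof -
    have "smooth (\<lambda>x::'a. \<Prod>b\<in>Basis. h ((c *\<^sub>R b) \<bullet> x + - (b \<bullet> w)))"
      by (intro smooth_prod smooth_compose_affine h(1))
    then show ?thesis by (simp add: \<beta>_def inner_diff_right)
  qed
  have smooth: "smooth \<beta>" using sm[of 1 0] by simp
  note D = smooth_has_derivative[OF smooth]
  have zero: "\<beta> y = 0" if "b \<in> Basis" "1 < \<bar>b \<bullet> y\<bar>" for y b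
    unfolding \<beta>_def using that h(3)[of "b \<bullet> y"] by (intro prod_zero) auto
  have Dzero: "frechet_derivative \<beta> (at y) v = 0" if b: "b \<in> Basis" "1 < \<bar>b \<bullet> y\<bar>" for y b v
  proof -
    \<comment> \<open>The strict inequality makes this region open, so the vanishing of
      \<open>\<beta>\<close> there passes to its derivative.\<close>
    have "open {y. 1 < \<bar>b \<bullet> y\<bar>}" by (intro open_Collect_less continuous_intros)
    moreover have "((\<lambda>_. 0) has_derivative (\<lambda>_. 0)) (at y)" by simp
    ultimately have "(\<beta> has_derivative (\<lambda>_. 0)) (at y)"
      using has_derivative_transform_within_open[of "\<lambda>_. 0" "\<lambda>_. 0" y UNIV "{y. 1 < \<bar>b \<bullet> y\<bar>}" \<beta>] b zero
      by simp
    from fun_cong[OF frechet_derivative_at[OF this], of v] show ?thesis by simp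
  qed
  have "\<exists>C. \<forall>y. \<bar>frechet_derivative \<beta> (at y) b\<bar> \<le> C" if "b \<in> Basis" for b
  proof -
    have "continuous_on (cbox (-One) One) (\<lambda>y. frechet_derivative \<beta> (at y) b)"
      by (rule smooth_continuous_on[OF smooth_partial[OF smooth that]])
    then have "bounded ((\<lambda>y. frechet_derivative \<beta> (at y) b) ` cbox (-One) One)"
      by (intro compact_imp_bounded compact_continuous_image compact_cbox)
    then obtain C where C: "\<And>y. y \<in> cbox (-One) One \<Longrightarrow> \<bar>frechet_derivative \<beta> (at y) b\<bar> \<le> C" "0 < C"
      unfolding bounded_pos by auto
    have "\<bar>frechet_derivative \<beta> (at y) b\<bar> \<le> C" for y
    proof (cases "y \<in> cbox (-One) One")
      case False
      then obtain b' where b': "b' \<in> Basis" "y \<bullet> b' < -1 \<or> 1 < y \<bullet> b'"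
        by (auto simp: mem_box not_le)
      then have "1 < \<bar>b' \<bullet> y\<bar>" by (auto simp: inner_commute)
      then show ?thesis using Dzero[OF b'(1)] C(2) by simp
    qed (use C in simp)
    then show ?thesis by blast
  qed
  then obtain B where B: "\<And>b y. b \<in> Basis \<Longrightarrow> \<bar>frechet_derivative \<beta> (at y) b\<bar> \<le> B b" by metis
  define C where "C = (\<Sum>b\<in>Basis. \<bar>B b\<bar>)"
  show ?thesis
  proof (rule that[of C \<beta>])
    show "0 \<le> C" by (simp add: C_def sum_nonneg)
    show "0 \<le> \<beta> y" for y unfolding \<beta>_def by (intro prod_nonneg) (use h in auto)
    show "\<bar>frechet_derivative \<beta> (at y) v\<bar> \<le> C * norm v" for y v
    proof -
      have lin: "linear (frechet_derivative \<beta> (at y))" by (rule has_derivative_linear[OF D])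
      have "frechet_derivative \<beta> (at y) v = frechet_derivative \<beta> (at y) (\<Sum>b\<in>Basis. (v \<bullet> b) *\<^sub>R b)"
        by (simp add: euclidean_representation)
      also have "\<dots> = (\<Sum>b\<in>Basis. (v \<bullet> b) * frechet_derivative \<beta> (at y) b)"
        by (simp add: linear_sum[OF lin] linear_cmul[OF lin])
      finally have "\<bar>frechet_derivative \<beta> (at y) v\<bar> \<le> (\<Sum>b\<in>Basis. \<bar>(v \<bullet> b) * frechet_derivative \<beta> (at y) b\<bar>)"
        by (simp add: sum_abs)
      also have "\<dots> \<le> (\<Sum>b\<in>Basis. \<bar>B b\<bar> * norm v)"
      proof (rule sum_mono)
        fix b :: 'a assume b: "b \<in> Basis"
        have "\<bar>v \<bullet> b\<bar> \<le> norm v" using b Basis_le_norm by (simp add: inner_commute)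
        moreover have "\<bar>frechet_derivative \<beta> (at y) b\<bar> \<le> \<bar>B b\<bar>" using B[OF b, of y] by linarith
        ultimately show "\<bar>(v \<bullet> b) * frechet_derivative \<beta> (at y) b\<bar> \<le> \<bar>B b\<bar> * norm v"
          by (subst mult.commute) (simp add: abs_mult mult_mono)
      qed
      finally show ?thesis by (simp add: C_def sum_distrib_right)
    qed
    show "(\<Sum>k\<in>PiE Basis (\<lambda>_. {-int N..int N}). \<beta> (y - grid_point k)) = 1"
      if "\<And>b. b \<in> Basis \<Longrightarrow> \<bar>b \<bullet> y\<bar> \<le> real N" for N y
    proof -
      have "(\<Sum>k\<in>PiE Basis (\<lambda>_. {-int N..int N}). \<beta> (y - grid_point k)) =
        (\<Sum>k\<in>PiE Basis (\<lambda>_. {-int N..int N}). \<Prod>b\<in>Basis. h (b \<bullet> y - of_int (k b)))"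
        by (simp add: \<beta>_def inner_diff_right grid_point_inner)
      also have "\<dots> = (\<Prod>b\<in>Basis. \<Sum>j\<in>{-int N..int N}. h (b \<bullet> y - of_int j))"
        by (rule prod_sum_PiE[symmetric]) auto
      also have "\<dots> = 1" by (intro prod.neutral ballI h(4) that)
      finally show ?thesis .
    qed
  qed (use sm zero Dzero D in auto)
qed

lemma grad_inner:
  assumes "(f has_derivative f') (at x)"
  shows "grad f x \<bullet> v = f' v"
proof -
  have f': "frechet_derivative f (at x) = f'" using frechet_derivative_at[OF assms] by simp
  have lin: "linear f'" by (rule has_derivative_linear[OF assms])
  have "f' v = f' (\<Sum>b\<in>Basis. (v \<bullet> b) *\<^sub>R b)" by (simp add: euclidean_representation)
  also have "\<dots> = (\<Sum>b\<in>Basis. (v \<bullet> b) * f' b)"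
    by (simp add: linear_sum[OF lin] linear_cmul[OF lin])
  finally show ?thesis by (simp add: grad_def f' inner_sum_left inner_commute[of v] mult.commute)
qed

text \<open>Glue the first-order Taylor polynomials at points of \<open>K\<close> near the nodes of a fine grid. The
  gradients of the bumps are of order \<open>1/r\<close> for mesh \<open>r\<close>, but the Taylor polynomials differ from
  \<open>\<phi>\<close> only by order \<open>\<epsilon> r\<close>, so the constant depends on the dimension alone.\<close>

lemma smooth_patching:
  obtains C :: real where "0 < C"
    "\<And>(K :: 'a::euclidean_space set) \<phi> df \<delta> \<epsilon>. \<lbrakk>compact K; 0 < \<delta>; 0 \<le> \<epsilon>;
      \<And>x y. x \<in> K \<Longrightarrow> y \<in> K \<Longrightarrow> dist x y \<le> \<delta> \<Longrightarrow> norm (df y - df x) \<le> \<epsilon>;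
      \<And>x y. x \<in> K \<Longrightarrow> y \<in> K \<Longrightarrow> dist x y \<le> \<delta> \<Longrightarrow>
        \<bar>\<phi> y - \<phi> x - df x \<bullet> (y - x)\<bar> \<le> \<epsilon> * dist x y\<rbrakk> \<Longrightarrow>
      \<exists>\<psi>\<in>Cc_infty. \<forall>x\<in>K. \<bar>\<phi> x - \<psi> x\<bar> \<le> C * \<epsilon> \<and> norm (df x - grad \<psi> x) \<le> C * \<epsilon>"
proof (rule smooth_grid_bump_exists)
  fix \<beta> :: "'a \<Rightarrow> real" and C0 :: real
  assume C0: "0 \<le> C0"
    and \<beta>_smooth: "\<And>c w. smooth (\<lambda>x. \<beta> (c *\<^sub>R x - w))" and \<beta>_nonneg: "\<And>y. 0 \<le> \<beta> y"
    and \<beta>_zero: "\<And>y b. b \<in> Basis \<Longrightarrow> 1 < \<bar>b \<bullet> y\<bar> \<Longrightarrow> \<beta> y = 0"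
    and \<beta>_deriv: "\<And>y. (\<beta> has_derivative frechet_derivative \<beta> (at y)) (at y)"
    and \<beta>_bound: "\<And>y v. \<bar>frechet_derivative \<beta> (at y) v\<bar> \<le> C0 * norm v"
    and D\<beta>_zero: "\<And>y b v. b \<in> Basis \<Longrightarrow> 1 < \<bar>b \<bullet> y\<bar> \<Longrightarrow> frechet_derivative \<beta> (at y) v = 0"
    and \<beta>_sum: "\<And>N y. (\<And>b. b \<in> Basis \<Longrightarrow> \<bar>b \<bullet> y\<bar> \<le> real N) \<Longrightarrow>
      (\<Sum>k\<in>PiE Basis (\<lambda>_. {-int N..int N}). \<beta> (y - grid_point k)) = 1"
  define d where "d = real DIM('a)"
  have d: "1 \<le> d" by (simp add: d_def DIM_positive Suc_leI)
  \<comment> \<open>The 1 covers the averaging errors. At most \<open>3 ^ DIM('a)\<close> bumps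
    matter at a point, each contributing a gradient of size \<open>C0 / r\<close> times a Taylor
    error \<open>\<epsilon> * (2 * r * d)\<close>; the mesh \<open>r\<close> cancels.\<close>
  define C where "C = 1 + 3 ^ DIM('a) * (2 * C0 * d)"
  show thesis
  proof (rule that[of C])
    show "0 < C" unfolding C_def using C0 d by (intro add_pos_nonneg) auto
    fix K :: "'a set" and \<phi> :: "'a \<Rightarrow> real" and df \<delta> \<epsilon>
    assume K: "compact K" and \<delta>: "0 < \<delta>" and \<epsilon>: "0 \<le> \<epsilon>"
      and uc: "\<And>x y. x \<in> K \<Longrightarrow> y \<in> K \<Longrightarrow> dist x y \<le> \<delta> \<Longrightarrow> norm (df y - df x) \<le> \<epsilon>"
      and ta: "\<And>x y. x \<in> K \<Longrightarrow> y \<in> K \<Longrightarrow> dist x y \<le> \<delta> \<Longrightarrow>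
        \<bar>\<phi> y - \<phi> x - df x \<bullet> (y - x)\<bar> \<le> \<epsilon> * dist x y"
    \<comment> \<open>Points near a common node are at most \<open>2 * r * d\<close> apart: at most
      \<open>\<delta>\<close>, so that the hypotheses apply, and at most 1, so that the value error
      is at most \<open>\<epsilon>\<close>.\<close>
    define r where "r = min \<delta> 1 / (2 * d)"
    have r: "0 < r" using \<delta> d by (simp add: r_def)
    have rd: "2 * r * d \<le> \<delta>" "2 * r * d \<le> 1" using d by (simp_all add: r_def)
    obtain R where R: "\<And>x. x \<in> K \<Longrightarrow> norm x \<le> R"
      using compact_imp_bounded[OF K] unfolding bounded_iff by blast
    \<comment> \<open>Finitely many nodes suffice; the strict bound leaves a neighbourhood of
      \<open>K\<close> on which the bumps still sum to 1.\<close>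
    obtain N :: nat where N: "R / r < real N" using reals_Archimedean2 by blast
    define Q where "Q = PiE (Basis :: 'a set) (\<lambda>_. {-int N..int N})"
    have finQ: "finite Q" unfolding Q_def by (intro finite_PiE) auto
    define y where "y k x = (1 / r) *\<^sub>R x - grid_point k" for k and x :: 'a
    define near where "near k x \<longleftrightarrow> (\<forall>b\<in>Basis. \<bar>b \<bullet> y k x\<bar> \<le> 1)" for k and x :: 'a
    \<comment> \<open>If no point of \<open>K\<close> is near node \<open>k\<close>, the choice is
      arbitrary, but then the bump of \<open>k\<close> and its derivative vanish on
      \<open>K\<close>.\<close>
    define Z where "Z k = (SOME z. z \<in> K \<and> near k z)" for k
    have Z: "Z k \<in> K" "near k (Z k)" if "x \<in> K" "near k x" for k x
      using someI[of "\<lambda>z. z \<in> K \<and> near k z" x] that by (auto simp: Z_def)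
    have near_dist: "dist (Z k) x \<le> 2 * r * d" if x: "x \<in> K" "near k x" for k x
    proof -
      have "\<bar>(Z k - x) \<bullet> b\<bar> \<le> 2 * r" if b: "b \<in> Basis" for b
      proof -
        have "\<bar>b \<bullet> y k x\<bar> \<le> 1" "\<bar>b \<bullet> y k (Z k)\<bar> \<le> 1"
          using x(2) Z(2)[OF x] b by (auto simp: near_def)
        then have "\<bar>b \<bullet> y k (Z k) - b \<bullet> y k x\<bar> \<le> 2" by linarith
        moreover have "(Z k - x) \<bullet> b = r * (b \<bullet> y k (Z k) - b \<bullet> y k x)"
          using r by (simp add: y_def inner_diff_right inner_diff_left inner_commute field_simps)
        ultimately show ?thesis using r by (simp add: abs_mult mult.commute)
      qed
      then have "(\<Sum>b\<in>Basis. \<bar>(Z k - x) \<bullet> b\<bar>) \<le> (\<Sum>b\<in>(Basis::'a set). 2 * r)" by (rule sum_mono)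
      then show ?thesis
        using norm_le_l1[of "Z k - x"] by (simp add: dist_norm d_def algebra_simps)
    qed
    \<comment> \<open>The Taylor polynomial at \<open>Z k\<close>, written as constant plus linear
      form to match the closure rules for \<open>smooth\<close>.\<close>
    define L where "L k x = (\<phi> (Z k) - df (Z k) \<bullet> Z k) + df (Z k) \<bullet> x" for k x
    define \<psi> where "\<psi> x = (\<Sum>k\<in>Q. \<beta> (y k x) * L k x)" for x
    have "smooth \<psi>"
      unfolding \<psi>_def y_def L_def
      by (intro smooth_sum smooth_mult smooth_add smooth_const smooth_inner \<beta>_smooth)
    have \<beta>_near: "near k x" if "\<beta> (y k x) \<noteq> 0" for k x
      using that \<beta>_zero[of _ "y k x"] unfolding near_def by (meson not_le)
    have "bounded {x. \<psi> x \<noteq> 0}"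
    proof (rule bounded_subset)
      show "bounded (\<Union>k\<in>Q. cball 0 (r * (d + norm (grid_point k))) :: 'a set)"
        using finQ by (intro bounded_UN) auto
      show "{x. \<psi> x \<noteq> 0} \<subseteq> (\<Union>k\<in>Q. cball 0 (r * (d + norm (grid_point k))))"
      proof
        fix x assume "x \<in> {x. \<psi> x \<noteq> 0}"
        then obtain k where k: "k \<in> Q" "\<beta> (y k x) \<noteq> 0"
          unfolding \<psi>_def by (metis (mono_tags, lifting) mem_Collect_eq mult_zero_left sum.neutral)
        have "norm (y k x) \<le> (\<Sum>b\<in>Basis. \<bar>y k x \<bullet> b\<bar>)" by (rule norm_le_l1)
        also have "\<dots> \<le> (\<Sum>b\<in>(Basis::'a set). 1)"
          using \<beta>_near[OF k(2)] by (intro sum_mono) (simp add: near_def inner_commute)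
        finally have 1: "norm (y k x) \<le> d" by (simp add: d_def)
        have "x = r *\<^sub>R (y k x + grid_point k)" using r by (simp add: y_def)
        then have "norm x = r * norm (y k x + grid_point k)" using r by (metis norm_scaleR abs_of_pos)
        also have "\<dots> \<le> r * (d + norm (grid_point k))"
          using 1 r norm_triangle_ineq[of "y k x" "grid_point k"] by (intro mult_left_mono) auto
        finally show "x \<in> (\<Union>k\<in>Q. cball 0 (r * (d + norm (grid_point k))))" using k(1) by auto
      qed
    qed
    then have "\<psi> \<in> Cc_infty" using \<open>smooth \<psi>\<close> by (simp add: Cc_infty_def compact_closure)
    moreover have "\<bar>\<phi> x - \<psi> x\<bar> \<le> C * \<epsilon> \<and> norm (df x - grad \<psi> x) \<le> C * \<epsilon>" if x: "x \<in> K" for x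
    proof
      define E where "E k v = frechet_derivative \<beta> (at (y k x)) ((1 / r) *\<^sub>R v)" for k v
      have \<beta>D: "((\<lambda>x. \<beta> (y k x)) has_derivative E k) (at x)" for k
      proof -
        have "((\<lambda>x. y k x) has_derivative (\<lambda>v. (1 / r) *\<^sub>R v)) (at x)"
          unfolding y_def by (auto intro!: derivative_eq_intros)
        from has_derivative_compose[OF this \<beta>_deriv] show ?thesis unfolding E_def .
      qed
      have E_near: "near k x" if "E k v \<noteq> 0" for k v
        using that D\<beta>_zero[of _ "y k x"] unfolding near_def E_def by (meson not_le)
      have E_bound: "\<bar>E k v\<bar> \<le> C0 / r * norm v" for k v
        using \<beta>_bound[of "y k x" "(1 / r) *\<^sub>R v"] r by (simp add: E_def)
      have L_near: "\<bar>L k x - \<phi> x\<bar> \<le> \<epsilon> * (2 * r * d)" if "near k x" for k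
      proof -
        have "\<bar>\<phi> x - \<phi> (Z k) - df (Z k) \<bullet> (x - Z k)\<bar> \<le> \<epsilon> * dist (Z k) x"
          using near_dist[OF x that] rd by (intro ta Z(1)[OF x that] x) linarith
        also have "\<dots> \<le> \<epsilon> * (2 * r * d)" using near_dist[OF x that] \<epsilon> by (intro mult_left_mono)
        finally show ?thesis by (simp add: L_def inner_diff_right abs_minus_commute algebra_simps)
      qed
      have df_near: "norm (df (Z k) - df x) \<le> \<epsilon>" if "near k x" for k
        using near_dist[OF x that] rd by (intro uc Z(1)[OF x that] x) (simp add: dist_commute)
      have sum1: "(\<Sum>k\<in>Q. \<beta> (y k z)) = 1" if "\<And>b. b \<in> Basis \<Longrightarrow> \<bar>b \<bullet> z\<bar> < r * real N" for z
        unfolding y_def Q_def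
      proof (rule \<beta>_sum)
        fix b :: 'a assume "b \<in> Basis"
        then have "\<bar>b \<bullet> z\<bar> < r * real N" by (rule that)
        then show "\<bar>b \<bullet> (1 / r) *\<^sub>R z\<bar> \<le> real N" using r by (simp add: field_simps abs_mult)
      qed
      have xN: "\<bar>b \<bullet> x\<bar> < r * real N" if "b \<in> Basis" for b
      proof -
        have "\<bar>b \<bullet> x\<bar> \<le> norm x" using Basis_le_norm[OF that, of x] by (simp add: inner_commute)
        also have "\<dots> \<le> R" by (rule R[OF x])
        also have "R < r * real N" using N r by (simp add: field_simps)
        finally show ?thesis .
      qed
      have sumx: "(\<Sum>k\<in>Q. \<beta> (y k x)) = 1" using sum1 xN by blast
      \<comment> \<open>Near \<open>x\<close> the bumps sum to the constant 1, so their derivatives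
        cancel. This permits subtracting \<open>\<phi> x\<close> from every \<open>L k x\<close> in
        the gradient.\<close>
      have sumE: "(\<Sum>k\<in>Q. E k v) = 0" for v
      proof -
        define U where "U = (\<Inter>b\<in>Basis. {z :: 'a. \<bar>b \<bullet> z\<bar> < r * real N})"
        have "open U" unfolding U_def
          by (intro open_INT ballI open_Collect_less continuous_intros) auto
        have "((\<lambda>z. \<Sum>k\<in>Q. \<beta> (y k z)) has_derivative (\<lambda>v. \<Sum>k\<in>Q. E k v)) (at x)"
          by (intro has_derivative_sum \<beta>D)
        then have "((\<lambda>z. 1 :: real) has_derivative (\<lambda>v. \<Sum>k\<in>Q. E k v)) (at x)"
          by (rule has_derivative_transform_within_open[OF _ \<open>open U\<close>])
             (use xN sum1 in \<open>auto simp: U_def\<close>)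
        moreover have "((\<lambda>z. 1 :: real) has_derivative (\<lambda>v. 0)) (at x)" by simp
        ultimately show ?thesis by (metis has_derivative_unique)
      qed
      \<comment> \<open>Nearness leaves each coordinate of \<open>k\<close> only the three integers
        around the floor of \<open>b \<bullet> x / r\<close>.\<close>
      have card_near: "real (card {k\<in>Q. near k x}) \<le> 3 ^ DIM('a)"
      proof -
        define P where "P = PiE (Basis::'a set) (\<lambda>b. {\<lfloor>b \<bullet> x / r\<rfloor> - 1..\<lfloor>b \<bullet> x / r\<rfloor> + 1})"
        have "finite P" unfolding P_def by (intro finite_PiE) auto
        moreover have "{k\<in>Q. near k x} \<subseteq> P"
        proof
          fix k assume k: "k \<in> {k\<in>Q. near k x}"
          have "k b \<in> {\<lfloor>b \<bullet> x / r\<rfloor> - 1..\<lfloor>b \<bullet> x / r\<rfloor> + 1}" if b: "b \<in> Basis" for b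
          proof -
            have "\<bar>b \<bullet> x / r - of_int (k b)\<bar> \<le> 1"
              using k b by (auto simp: near_def y_def inner_diff_right grid_point_inner)
            then show ?thesis by (simp add: abs_le_iff) linarith
          qed
          then show "k \<in> P" using k by (auto simp: P_def Q_def PiE_iff)
        qed
        ultimately have "card {k\<in>Q. near k x} \<le> card P" by (rule card_mono)
        also have "card P = 3 ^ DIM('a)" unfolding P_def by (subst card_PiE) auto
        finally show ?thesis by (metis of_nat_le_iff of_nat_numeral of_nat_power)
      qed
      \<comment> \<open>The error is a convex combination of the Taylor errors, since the weights
        sum to 1.\<close>
      have "\<psi> x - \<phi> x = (\<Sum>k\<in>Q. \<beta> (y k x) * (L k x - \<phi> x))"
        by (simp add: \<psi>_def right_diff_distrib sum_subtractf sum_distrib_right[symmetric] sumx)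
      also have "\<bar>\<dots>\<bar> \<le> (\<Sum>k\<in>Q. \<bar>\<beta> (y k x) * (L k x - \<phi> x)\<bar>)" by (rule sum_abs)
      also have "\<dots> \<le> (\<Sum>k\<in>Q. \<beta> (y k x) * (\<epsilon> * (2 * r * d)))"
      proof (rule sum_mono)
        fix k
        show "\<bar>\<beta> (y k x) * (L k x - \<phi> x)\<bar> \<le> \<beta> (y k x) * (\<epsilon> * (2 * r * d))"
          using \<beta>_near[of k x] L_near[of k] \<beta>_nonneg[of "y k x"]
          by (cases "\<beta> (y k x) = 0") (auto simp: abs_mult intro!: mult_left_mono)
      qed
      also have "\<dots> = \<epsilon> * (2 * r * d)" by (simp add: sum_distrib_right[symmetric] sumx)
      also have "\<dots> \<le> \<epsilon> * 1" using rd \<epsilon> by (intro mult_left_mono)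
      also have "\<dots> \<le> C * \<epsilon>" using \<epsilon> C0 d by (simp add: C_def algebra_simps)
      finally show "\<bar>\<phi> x - \<psi> x\<bar> \<le> C * \<epsilon>" by (simp add: abs_minus_commute)

      have "(\<psi> has_derivative (\<lambda>v. \<Sum>k\<in>Q. \<beta> (y k x) * (df (Z k) \<bullet> v) + E k v * L k x)) (at x)"
        unfolding \<psi>_def
        by (intro has_derivative_sum has_derivative_mult \<beta>D) (auto simp: L_def intro!: derivative_eq_intros)
      note grad = grad_inner[OF this]
      \<comment> \<open>Testing the gradient error against itself reduces the norm bound to a bound
        on a directional derivative; one factor \<open>norm w\<close> is cancelled at the
        end.\<close>
      define w where "w = grad \<psi> x - df x"
      have "w \<bullet> w = (\<Sum>k\<in>Q. \<beta> (y k x) * (df (Z k) \<bullet> w) + E k w * L k x) - df x \<bullet> w"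
        by (subst (1) w_def) (simp add: inner_diff_left grad)
      also have "\<dots> = (\<Sum>k\<in>Q. \<beta> (y k x) * ((df (Z k) - df x) \<bullet> w)) + (\<Sum>k\<in>Q. E k w * (L k x - \<phi> x))"
        by (simp add: sum.distrib inner_diff_left right_diff_distrib sum_subtractf
            sum_distrib_right[symmetric] sumx sumE)
      also have "\<dots> \<le> \<epsilon> * norm w + 3 ^ DIM('a) * (2 * C0 * d) * \<epsilon> * norm w"
      proof (rule add_mono)
        have "(\<Sum>k\<in>Q. \<beta> (y k x) * ((df (Z k) - df x) \<bullet> w)) \<le> (\<Sum>k\<in>Q. \<beta> (y k x) * (\<epsilon> * norm w))"
        proof (rule sum_mono)
          fix k
          show "\<beta> (y k x) * ((df (Z k) - df x) \<bullet> w) \<le> \<beta> (y k x) * (\<epsilon> * norm w)"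
          proof (cases "\<beta> (y k x) = 0")
            case False
            have "(df (Z k) - df x) \<bullet> w \<le> norm (df (Z k) - df x) * norm w" by (rule norm_cauchy_schwarz)
            also have "\<dots> \<le> \<epsilon> * norm w" using df_near[OF \<beta>_near[OF False]] by (intro mult_right_mono) auto
            finally show ?thesis using \<beta>_nonneg by (intro mult_left_mono)
          qed auto
        qed
        then show "(\<Sum>k\<in>Q. \<beta> (y k x) * ((df (Z k) - df x) \<bullet> w)) \<le> \<epsilon> * norm w"
          by (simp add: sum_distrib_right[symmetric] sumx)
      next
        have "(\<Sum>k\<in>Q. E k w * (L k x - \<phi> x)) = (\<Sum>k\<in>{k\<in>Q. near k x}. E k w * (L k x - \<phi> x))"
          using E_near finQ by (intro sum.mono_neutral_right) auto
        also have "\<dots> \<le> (\<Sum>k\<in>{k\<in>Q. near k x}. (C0 / r * norm w) * (\<epsilon> * (2 * r * d)))"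
        proof (rule sum_mono)
          fix k assume "k \<in> {k\<in>Q. near k x}"
          then have "\<bar>E k w\<bar> * \<bar>L k x - \<phi> x\<bar> \<le> (C0 / r * norm w) * (\<epsilon> * (2 * r * d))"
            using E_bound[of k w] L_near[of k] C0 r by (intro mult_mono) auto
          then show "E k w * (L k x - \<phi> x) \<le> (C0 / r * norm w) * (\<epsilon> * (2 * r * d))"
            by (metis abs_mult abs_le_D1)
        qed
        also have "\<dots> = real (card {k\<in>Q. near k x}) * ((2 * C0 * d) * \<epsilon> * norm w)"
          using r by (simp add: field_simps)
        also have "\<dots> \<le> 3 ^ DIM('a) * ((2 * C0 * d) * \<epsilon> * norm w)"
          using card_near C0 d \<epsilon> by (intro mult_right_mono) auto
        finally show "(\<Sum>k\<in>Q. E k w * (L k x - \<phi> x)) \<le> 3 ^ DIM('a) * (2 * C0 * d) * \<epsilon> * norm w"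
          by (simp add: mult.assoc)
      qed
      also have "\<dots> = (C * \<epsilon>) * norm w" by (simp add: C_def algebra_simps)
      finally have "norm w * norm w \<le> (C * \<epsilon>) * norm w" by (simp add: dot_square_norm power2_eq_square)
      moreover have "0 \<le> C * \<epsilon>" using C0 d \<epsilon> by (simp add: C_def)
      ultimately have "norm w \<le> C * \<epsilon>" by (cases "norm w = 0") auto
      then show "norm (df x - grad \<psi> x) \<le> C * \<epsilon>" by (simp add: w_def norm_minus_commute)
    qed
    ultimately show "\<exists>\<psi>\<in>Cc_infty. \<forall>x\<in>K. \<bar>\<phi> x - \<psi> x\<bar> \<le> C * \<epsilon> \<and> norm (df x - grad \<psi> x) \<le> C * \<epsilon>"
      by blast
  qed
qed

lemma Cc_infty_approximation:
  fixes K :: "'a::euclidean_space set"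
  assumes K: "compact K" and f: "is_cont_deriv K f df" and e: "0 < e"
  obtains \<psi> where "\<psi> \<in> Cc_infty" "\<And>x. x \<in> K \<Longrightarrow> \<bar>f x - \<psi> x\<bar> \<le> e"
    "\<And>x. x \<in> K \<Longrightarrow> norm (df x - grad \<psi> x) \<le> e"
proof (rule smooth_patching)
  fix C :: real
  assume C: "0 < C"
    "\<And>(K :: 'a set) \<phi> df \<delta> \<epsilon>. \<lbrakk>compact K; 0 < \<delta>; 0 \<le> \<epsilon>;
      \<And>x y. x \<in> K \<Longrightarrow> y \<in> K \<Longrightarrow> dist x y \<le> \<delta> \<Longrightarrow> norm (df y - df x) \<le> \<epsilon>;
      \<And>x y. x \<in> K \<Longrightarrow> y \<in> K \<Longrightarrow> dist x y \<le> \<delta> \<Longrightarrow>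
        \<bar>\<phi> y - \<phi> x - df x \<bullet> (y - x)\<bar> \<le> \<epsilon> * dist x y\<rbrakk> \<Longrightarrow>
      \<exists>\<psi>\<in>Cc_infty. \<forall>x\<in>K. \<bar>\<phi> x - \<psi> x\<bar> \<le> C * \<epsilon> \<and> norm (df x - grad \<psi> x) \<le> C * \<epsilon>"
  \<comment> \<open>Patching is applied with \<open>2 * \<epsilon>\<close>, the error supplied by
    the cost function, and \<open>C * (2 * \<epsilon>)\<close> is \<open>e / 2\<close>; the other
    half is the distance from \<open>f\<close> to \<open>\<phi>\<close>.\<close>
  define \<epsilon> where "\<epsilon> = e / (4 * C)"
  have \<epsilon>: "0 < \<epsilon>" using e C(1) by (simp add: \<epsilon>_def)
  obtain \<phi> \<delta> where \<phi>: "0 < \<delta>" "\<And>x. x \<in> K \<Longrightarrow> \<bar>f x - \<phi> x\<bar> \<le> e / 2"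
    "\<And>x y. x \<in> K \<Longrightarrow> y \<in> K \<Longrightarrow> dist x y \<le> \<delta> \<Longrightarrow> norm (df y - df x) \<le> \<epsilon>"
    "\<And>x y. x \<in> K \<Longrightarrow> y \<in> K \<Longrightarrow> dist x y \<le> \<delta> \<Longrightarrow>
      \<bar>\<phi> y - \<phi> x - df x \<bullet> (y - x)\<bar> \<le> 2 * \<epsilon> * dist x y"
    using uniform_derivative_approximation[OF K f \<epsilon>, of "e / 2"] e by (metis half_gt_zero)
  have "\<exists>\<psi>\<in>Cc_infty. \<forall>x\<in>K. \<bar>\<phi> x - \<psi> x\<bar> \<le> C * (2 * \<epsilon>) \<and> norm (df x - grad \<psi> x) \<le> C * (2 * \<epsilon>)"
  proof (rule C(2)[OF K \<phi>(1)])
    fix x y assume xy: "x \<in> K" "y \<in> K" "dist x y \<le> \<delta>"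
    show "norm (df y - df x) \<le> 2 * \<epsilon>" using \<phi>(3)[OF xy] \<epsilon> by linarith
    show "\<bar>\<phi> y - \<phi> x - df x \<bullet> (y - x)\<bar> \<le> 2 * \<epsilon> * dist x y" by (rule \<phi>(4)[OF xy])
  qed (use \<epsilon> in simp)
  moreover have "C * (2 * \<epsilon>) = e / 2" using C(1) by (simp add: \<epsilon>_def)
  ultimately obtain \<psi> where \<psi>: "\<psi> \<in> Cc_infty" "\<And>x. x \<in> K \<Longrightarrow> \<bar>\<phi> x - \<psi> x\<bar> \<le> e / 2"
    "\<And>x. x \<in> K \<Longrightarrow> norm (df x - grad \<psi> x) \<le> e / 2" by auto
  show thesis
  proof (rule that[OF \<psi>(1)])
    fix x assume x: "x \<in> K"
    show "\<bar>f x - \<psi> x\<bar> \<le> e" using \<phi>(2)[OF x] \<psi>(2)[OF x] by linarith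
    show "norm (df x - grad \<psi> x) \<le> e" using \<psi>(3)[OF x] e by linarith
  qed
qed

section \<open>Density\<close>

lemma smooth_grad_continuous_on: "smooth f \<Longrightarrow> continuous_on A (grad f)"
  unfolding grad_def
  by (intro continuous_on_sum continuous_on_scaleR continuous_on_const smooth_continuous_on smooth_partial)

lemma smooth_has_derivative_grad:
  assumes "smooth f"
  shows "(f has_derivative (\<lambda>v. grad f x \<bullet> v)) (at x)"
  unfolding grad_inner[OF smooth_has_derivative[OF assms]] by (rule smooth_has_derivative[OF assms])

lemma is_cont_deriv_smooth:
  assumes "smooth f"
  shows "is_cont_deriv K f (grad f)"
  unfolding is_cont_deriv_def
proof (intro conjI ballI)
  show "continuous_on K (grad f)" by (rule smooth_grad_continuous_on[OF assms])
  fix x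
  have "(f has_derivative (\<lambda>v. grad f x \<bullet> v)) (at x within K)"
    by (rule has_derivative_at_withinI[OF smooth_has_derivative_grad[OF assms]])
  then show "((\<lambda>y. (f y - f x - grad f x \<bullet> (y - x)) / norm (y - x)) \<longlongrightarrow> 0) (at x within K)"
    by (simp add: has_derivative_within divide_inverse mult.commute diff_diff_eq)
qed

lemma is_cont_deriv_diff:
  assumes "is_cont_deriv K f df" "is_cont_deriv K g dg"
  shows "is_cont_deriv K (\<lambda>x. f x - g x) (\<lambda>x. df x - dg x)"
  unfolding is_cont_deriv_def
proof (intro conjI ballI)
  show "continuous_on K (\<lambda>x. df x - dg x)"
    using assms by (auto simp: is_cont_deriv_def intro: continuous_on_diff)
  fix x assume "x \<in> K"
  then have "((\<lambda>y. (f y - f x - df x \<bullet> (y - x)) / norm (y - x) -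
      (g y - g x - dg x \<bullet> (y - x)) / norm (y - x)) \<longlongrightarrow> 0 - 0) (at x within K)"
    using assms by (intro tendsto_diff) (auto simp: is_cont_deriv_def)
  then show "((\<lambda>y. (f y - g y - (f x - g x) - (df x - dg x) \<bullet> (y - x)) / norm (y - x)) \<longlongrightarrow> 0) (at x within K)"
    by (simp add: diff_divide_distrib[symmetric] inner_diff_left algebra_simps)
qed

text \<open>The condition \<open>0 \<le> e\<close> handles empty \<open>K\<close>, where
  \<open>supnorm\<close> is 0 by convention.\<close>

lemma supnorm_le:
  assumes "\<And>x. x \<in> K \<Longrightarrow> norm (g x) \<le> e" "0 \<le> e"
  shows "supnorm K g \<le> e"
  using assms by (auto simp: supnorm_def intro: cSUP_least)

lemma supnorm_nonneg:
  assumes "compact K" "continuous_on K g"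
  shows "0 \<le> supnorm K g"
proof (cases "K = {}")
  case False
  then obtain x where x: "x \<in> K" by blast
  have "bdd_above ((\<lambda>x. norm (g x)) ` K)"
    using assms by (intro bounded_imp_bdd_above compact_imp_bounded compact_continuous_image continuous_on_norm)
  from cSUP_upper2[OF this x norm_ge_zero] show ?thesis using False by (simp add: supnorm_def)
qed (simp add: supnorm_def)

text \<open>Every continuous derivative competes in the infimum; compactness makes the competing
  norms nonnegative, so the infimum is a genuine lower bound.\<close>

lemma C1K_norm_le_J1_norm:
  assumes "compact K" "is_cont_deriv K f df"
  shows "C1K_norm K f \<le> J1_norm K (f, df)"
proof -
  have "Inf {supnorm K df | df. is_cont_deriv K f df} \<le> supnorm K df"
  proof (rule cInf_lower)
    show "supnorm K df \<in> {supnorm K df | df. is_cont_deriv K f df}" using assms(2) by blast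
    show "bdd_below {supnorm K df | df. is_cont_deriv K f df}"
      by (rule bdd_belowI[of _ 0]) (auto simp: is_cont_deriv_def supnorm_nonneg[OF assms(1)])
  qed
  then show ?thesis by (simp add: C1K_norm_def J1_norm_def)
qed

theorem mainTheorem11:
  fixes K :: "'a::euclidean_space set"
  assumes "compact K"
  shows "(\<forall>p\<in>J1 K. \<forall>\<epsilon>>0. \<exists>\<phi>\<in>Cc_infty.
            J1_norm K (\<lambda>x. fst p x - \<phi> x, \<lambda>x. snd p x - grad \<phi> x) < \<epsilon>)
       \<and> (\<forall>f\<in>C1K K. \<forall>\<epsilon>>0. \<exists>g\<in>C1_Rd. C1K_norm K (\<lambda>x. f x - g x) < \<epsilon>)"
proof -
  have dense: "\<exists>\<phi>\<in>Cc_infty. J1_norm K (\<lambda>x. f x - \<phi> x, \<lambda>x. df x - grad \<phi> x) < \<epsilon>"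
    if f: "is_cont_deriv K f df" and \<epsilon>: "0 < \<epsilon>" for f df \<epsilon>
  proof -
    have "0 < \<epsilon> / 3" using \<epsilon> by simp
    then obtain \<psi> where \<psi>: "\<psi> \<in> Cc_infty" "\<And>x. x \<in> K \<Longrightarrow> \<bar>f x - \<psi> x\<bar> \<le> \<epsilon> / 3"
      "\<And>x. x \<in> K \<Longrightarrow> norm (df x - grad \<psi> x) \<le> \<epsilon> / 3"
      using Cc_infty_approximation[OF assms f] by metis
    have "supnorm K (\<lambda>x. f x - \<psi> x) \<le> \<epsilon> / 3"
      by (rule supnorm_le) (use \<psi>(2) \<epsilon> in auto)
    moreover have "supnorm K (\<lambda>x. df x - grad \<psi> x) \<le> \<epsilon> / 3"
      by (rule supnorm_le) (use \<psi>(3) \<epsilon> in auto)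
    ultimately have "J1_norm K (\<lambda>x. f x - \<psi> x, \<lambda>x. df x - grad \<psi> x) < \<epsilon>"
      using \<epsilon> by (simp add: J1_norm_def)
    then show ?thesis using \<psi>(1) by blast
  qed
  show ?thesis
  proof (intro conjI ballI allI impI)
    fix p \<epsilon> assume "p \<in> J1 K" "(0::real) < \<epsilon>"
    then show "\<exists>\<phi>\<in>Cc_infty. J1_norm K (\<lambda>x. fst p x - \<phi> x, \<lambda>x. snd p x - grad \<phi> x) < \<epsilon>"
      by (intro dense) (auto simp: J1_def)
  next
    fix f \<epsilon> assume "f \<in> C1K K" "(0::real) < \<epsilon>"
    then obtain df where f: "is_cont_deriv K f df" by (auto simp: C1K_def)
    obtain \<phi> where \<phi>: "\<phi> \<in> Cc_infty"
      "J1_norm K (\<lambda>x. f x - \<phi> x, \<lambda>x. df x - grad \<phi> x) < \<epsilon>"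
      using dense[OF f \<open>0 < \<epsilon>\<close>] by blast
    have smooth: "smooth \<phi>" using \<phi>(1) by (simp add: Cc_infty_def)
    \<comment> \<open>The approximant of the pair also serves for the quotient norm, since
      \<open>df - grad \<phi>\<close> is one continuous derivative of \<open>f - \<phi>\<close> on
      \<open>K\<close>.\<close>
    then have "\<phi> \<in> C1_Rd"
      unfolding C1_Rd_def
      using smooth_grad_continuous_on smooth_has_derivative_grad by blast
    moreover have "C1K_norm K (\<lambda>x. f x - \<phi> x) < \<epsilon>"
      using C1K_norm_le_J1_norm[OF assms is_cont_deriv_diff[OF f is_cont_deriv_smooth[OF smooth]]] \<phi>(2)
      by linarith
    ultimately show "\<exists>g\<in>C1_Rd. C1K_norm K (\<lambda>x. f x - g x) < \<epsilon>" by blast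
  qed
qed

end
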